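(* At all the finite singular points $z_j$, $j=1,\dots,m$, with the exception of $z_j=0$, the coefficient functions satisfy the bilinear identities (the third and fourth for $n\ge1$, the others for $n\ge0$) $$\Omega_n^2(z_j)=\frac{\kappa_n\phi_{n+2}(0)}{\kappa_{n+1}\phi_{n+1}(0)}z_j\Theta_n(z_j)\Theta_{n+1}(z_j)+V^2(z_j),$$ $$\Omega_n^{*2}(z_j)=\frac{\kappa_n\bar\phi_{n+2}(0)}{\kappa_{n+1}\bar\phi_{n+1}(0)}z_j\Theta^*_n(z_j)\Theta^*_{n+1}(z_j)+V^2(z_j),$$ $$\left[\Omega_{n-1}(z_j)-\frac{\kappa_{n-1}^2}{\kappa_n^2}\frac{\phi_{n+1}(0)}{\phi_n(0)}\Theta_n(z_j)\right]^2=\frac{\kappa_{n-1}\phi_{n+1}(0)\bar\phi_n(0)}{\kappa_n^3}\Theta_n(z_j)\Theta^*_{n-1}(z_j)+V^2(z_j),$$ $$\left[\Omega^*_{n-1}(z_j)-\frac{\kappa_{n-1}^2}{\kappa_n^2}\frac{\bar\phi_{n+1}(0)}{\bar\phi_n(0)}z_j\Theta^*_n(z_j)\right]^2=\frac{\kappa_{n-1}\bar\phi_{n+1}(0)\phi_n(0)}{\kappa_n^3}z_j^2\Theta^*_n(z_j)\Theta_{n-1}(z_j)+V^2(z_j),$$ $$\frac{\phi_{n+1}(0)\bar\phi_{n+1}(0)}{\kappa_n^2}z_j\Theta_n(z_j)\Theta^*_n(z_j)+V^2(z_j)=\left[\Omega_n(z_j)-\frac{\kappa_{n+1}}{\ka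ppa_n}z_j\Theta_n(z_j)\right]^2=\left[\Omega^*_n(z_j)-\frac{\kappa_{n+1}}{\kappa_n}\Theta^*_n(z_j)\right]^2.$$
   Context: Regular semi-classical weight: $w(z)=\prod_{j=1}^m(z-z_j)^{\rho_j}$ with $m\ge2$ distinct points $z_j\in\mathbb C$, exponents $\rho_j\in\mathbb C\setminus\mathbb Z_{\ge0}$, and $W(z)=\prod_{j=1}^m(z-z_j)$, $\frac{2V(z)}{W(z)}=\sum_{j=1}^m\frac{\rho_j}{z-z_j}$, so that $Ww'=2Vw$; one of the $z_j$ is $0$, i.e. $W(0)=0$. A branch of $w$ analytic in a cut plane is fixed; let $\mathbb T=\{|\zeta|=1\}$ be parametrised by $\zeta=e^{i\theta}$, $\theta\in(-\pi,\pi]$, the cuts being such that on $\mathbb T$ the branch is analytic except possibly at $-1$ and at those $z_j$ lying on $\mathbb T$. Assume $w(e^{\pi i})=w(e^{-\pi i})$ and $z^jw,z^jw'\in L^1(\mathbb T)$ for all $j\in\mathbb Z$. Let $w_k=\int_{\mathbb T}\frac{d\zeta}{2\pi i\zeta}w(\zeta)\zeta^{-k}$ and assume $\det[w_{j-k}]_{0\le j,k\le n-1}\neq0$ for all $n\ge1$. The bi-orthonormal polynomials are $\phi_n(z)=\kappa_nz^n+\dots+\phi_n(0)$ and $\bar\phi_n(z)=\kappa_nz^n+\dots+\bar\phi_n(0)$ with $\kappa_n\neq0$, satisfying $\int_{\mathbb T}\frac{d\zeta}{2\pi i\zeta}w(\zeta)\phi_m(\zeta)\bar\phi_n(\bar\zeta)=\delta_{m,n}$,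 $\bar\zeta=\zeta^{-1}$; the bar on $\bar\phi_n$ is notation, not complex conjugation. $\phi^*_n(z)=z^n\bar\phi_n(1/z)$. Assume $\phi_n(0)\ne0$, $\bar\phi_n(0)\neq0$ for all $n$. With $F(z)=\int_{\mathbb T}\frac{d\zeta}{2\pi i\zeta}\frac{\zeta+z}{\zeta-z}w(\zeta)$, for $z\notin\mathbb T$ put $\epsilon_n(z)=\int_{\mathbb T}\frac{d\zeta}{2\pi i\zeta}\frac{\zeta+z}{\zeta-z}w(\zeta)\phi_n(\zeta)$, $\epsilon^*_n(z)=-z^n\int_{\mathbb T}\frac{d\zeta}{2\pi i\zeta}\frac{\zeta+z}{\zeta-z}w(\zeta)\bar\phi_n(\bar\zeta)$ for $n\ge1$, and $\epsilon_0=1/\kappa_0+\kappa_0F$, $\epsilon^*_0=1/\kappa_0-\kappa_0F$. The coefficient functions $\Theta_n,\Omega_n,\Theta^*_n,\Omega^*_n$ (which for these weights are polynomials in $z$) are the functions determined by ($'=d/dz$) $W\phi'_n=\Theta_n\phi_{n+1}-(\Omega_n+V)\phi_n$, $W\epsilon'_n=\Theta_n\epsilon_{n+1}-(\Omega_n-V)\epsilon_n$, $W\phi^{*\prime}_n=-\Theta^*_n\phi^*_{n+1}+(\Omega^*_n-V)\phi^*_n$, $W\epsilon^{*\prime}_n=-\Theta^*_n\epsilon^*_{n+1}+(\Omega^*_n+V)\epsilon^*_n$. *)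

theory Defs
  imports "HOL-Complex_Analysis.Complex_Analysis" "Jordan_Normal_Form.Determinant"
begin

definition W_poly :: "nat \<Rightarrow> (nat \<Rightarrow> complex) \<Rightarrow> complex poly" where
  "W_poly m zs = (\<Prod>j\<in>{1..m}. [:- zs j, 1:])"

text \<open>Clearing denominators in \<open>2 V(z) / W(z) = (\<Sum>j=1..m. \<rho>\<^sub>j / (z - z\<^sub>j))\<close>.\<close>
definition V_poly :: "nat \<Rightarrow> (nat \<Rightarrow> complex) \<Rightarrow> (nat \<Rightarrow> complex) \<Rightarrow> complex poly" where
  "V_poly m zs \<rho> = (\<Sum>j\<in>{1..m}. Polynomial.smult (\<rho> j / 2) (\<Prod>k\<in>{1..m} - {j}. [:- zs k, 1:]))"

text \<open>A cut is a simple arc, either between two finite points or from a finite point to infinity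
  (a closed subset of the plane homeomorphic to a half-line is unbounded).\<close>
definition is_cut :: "complex set \<Rightarrow> bool" where
  "is_cut \<Gamma> \<longleftrightarrow> closed \<Gamma> \<and> (\<Gamma> homeomorphic {0..1::real} \<or> \<Gamma> homeomorphic {0::real..})"

definition cut_plane :: "complex set \<Rightarrow> bool" where
  "cut_plane D \<longleftrightarrow> connected D \<and> (\<exists>C. finite C \<and> (\<forall>\<Gamma>\<in>C. is_cut \<Gamma>) \<and> D = UNIV - \<Union>C)"

text \<open>A branch on \<open>D\<close> of the multivalued function \<open>(\<Prod>j=1..m. (z - z\<^sub>j) ^ \<rho>\<^sub>j)\<close>: an analytic
  selection of its values, where \<open>l j\<close> ranges over the logarithms of \<open>z - z\<^sub>j\<close>. The values of
  \<open>w\<close> outside \<open>D\<close> are unconstrained. Since an exponential never vanishes, no \<open>z\<^sub>j\<close> lies in \<open>D\<close>.\<close>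
definition weight_branch ::
  "nat \<Rightarrow> (nat \<Rightarrow> complex) \<Rightarrow> (nat \<Rightarrow> complex) \<Rightarrow> complex set \<Rightarrow> (complex \<Rightarrow> complex) \<Rightarrow> bool" where
  "weight_branch m zs \<rho> D w \<longleftrightarrow> w holomorphic_on D \<and>
     (\<forall>z\<in>D. \<exists>l. (\<forall>j\<in>{1..m}. exp (l j) = z - zs j) \<and> w z = (\<Prod>j\<in>{1..m}. exp (\<rho> j * l j)))"

definition circle_integrable :: "(complex \<Rightarrow> complex) \<Rightarrow> bool" where
  "circle_integrable f \<longleftrightarrow> set_integrable lborel {-pi<..pi} (\<lambda>\<theta>. f (cis \<theta>))"

text \<open>The integral of \<open>f\<close> over the unit circle against \<open>d\<zeta> / (2 \<pi> i \<zeta>) = d\<theta> / (2 \<pi>)\<close>.\<close>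
definition circle_int :: "(complex \<Rightarrow> complex) \<Rightarrow> complex" where
  "circle_int f = (LINT \<theta>:{-pi<..pi}|lborel. f (cis \<theta>)) / (2 * of_real pi)"

definition moment :: "(complex \<Rightarrow> complex) \<Rightarrow> int \<Rightarrow> complex" where
  "moment w k = circle_int (\<lambda>\<zeta>. w \<zeta> * \<zeta> powi (- k))"

definition toeplitz_det :: "(complex \<Rightarrow> complex) \<Rightarrow> nat \<Rightarrow> complex" where
  "toeplitz_det w n = Determinant.det (Matrix.mat n n (\<lambda>(j, k). moment w (int j - int k)))"

text \<open>The polynomials \<open>\<phi>b n\<close> play the role of \<open>\<phi>\<close>-bar, a sequence independent of \<open>\<phi>\<close>; no complex
  conjugation of coefficients is involved, and on the unit circle \<open>\<zeta>\<close>-bar is \<open>1 / \<zeta>\<close>.\<close>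
definition biorthonormal ::
  "(complex \<Rightarrow> complex) \<Rightarrow> (nat \<Rightarrow> complex) \<Rightarrow> (nat \<Rightarrow> complex poly) \<Rightarrow> (nat \<Rightarrow> complex poly) \<Rightarrow> bool" where
  "biorthonormal w \<kappa> \<phi> \<phi>b \<longleftrightarrow>
     (\<forall>n. \<kappa> n \<noteq> 0 \<and> degree (\<phi> n) = n \<and> lead_coeff (\<phi> n) = \<kappa> n
        \<and> degree (\<phi>b n) = n \<and> lead_coeff (\<phi>b n) = \<kappa> n) \<and>
     (\<forall>k n. circle_int (\<lambda>\<zeta>. w \<zeta> * poly (\<phi> k) \<zeta> * poly (\<phi>b n) (1 / \<zeta>)) = (if k = n then 1 else 0))"

text \<open>For \<open>\<phi>b n\<close> of degree \<open>n\<close> this is \<open>z ^ n * \<phi>b\<^sub>n (1 / z)\<close>.\<close>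
definition phi_star :: "(nat \<Rightarrow> complex poly) \<Rightarrow> nat \<Rightarrow> complex poly" where
  "phi_star \<phi>b n = reflect_poly (\<phi>b n)"

definition F_fun :: "(complex \<Rightarrow> complex) \<Rightarrow> complex \<Rightarrow> complex" where
  "F_fun w z = circle_int (\<lambda>\<zeta>. (\<zeta> + z) / (\<zeta> - z) * w \<zeta>)"

text \<open>The functions \<open>F\<close>, \<open>\<epsilon>\<close>, \<open>\<epsilon>*\<close> are meaningful only off the unit circle.\<close>
definition eps ::
  "(complex \<Rightarrow> complex) \<Rightarrow> (nat \<Rightarrow> complex) \<Rightarrow> (nat \<Rightarrow> complex poly) \<Rightarrow> nat \<Rightarrow> complex \<Rightarrow> complex" where
  "eps w \<kappa> \<phi> n z =
     (if n = 0 then 1 / \<kappa> 0 + \<kappa> 0 * F_fun w z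
      else circle_int (\<lambda>\<zeta>. (\<zeta> + z) / (\<zeta> - z) * w \<zeta> * poly (\<phi> n) \<zeta>))"

definition eps_star ::
  "(complex \<Rightarrow> complex) \<Rightarrow> (nat \<Rightarrow> complex) \<Rightarrow> (nat \<Rightarrow> complex poly) \<Rightarrow> nat \<Rightarrow> complex \<Rightarrow> complex" where
  "eps_star w \<kappa> \<phi>b n z =
     (if n = 0 then 1 / \<kappa> 0 - \<kappa> 0 * F_fun w z
      else - (z ^ n) * circle_int (\<lambda>\<zeta>. (\<zeta> + z) / (\<zeta> - z) * w \<zeta> * poly (\<phi>b n) (1 / \<zeta>)))"

text \<open>The defining differential relations of the coefficient functions. Being polynomials, these
  have well-defined values also at those \<open>z\<^sub>j\<close> lying on the unit circle, where \<open>\<epsilon>\<close> and \<open>\<epsilon>*\<close>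
  do not.\<close>
definition coefficient_functions ::
  "complex poly \<Rightarrow> complex poly \<Rightarrow> (complex \<Rightarrow> complex) \<Rightarrow> (nat \<Rightarrow> complex) \<Rightarrow>
   (nat \<Rightarrow> complex poly) \<Rightarrow> (nat \<Rightarrow> complex poly) \<Rightarrow>
   (nat \<Rightarrow> complex poly) \<Rightarrow> (nat \<Rightarrow> complex poly) \<Rightarrow>
   (nat \<Rightarrow> complex poly) \<Rightarrow> (nat \<Rightarrow> complex poly) \<Rightarrow> bool" where
  "coefficient_functions W V w \<kappa> \<phi> \<phi>b \<Theta> \<Omega> \<Theta>s \<Omega>s \<longleftrightarrow>
     (\<forall>n.
       W * pderiv (\<phi> n) = \<Theta> n * \<phi> (n+1) - (\<Omega> n + V) * \<phi> n \<and>
       W * pderiv (phi_star \<phi>b n) =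
         - \<Theta>s n * phi_star \<phi>b (n+1) + (\<Omega>s n - V) * phi_star \<phi>b n \<and>
       (\<forall>z. norm z \<noteq> 1 \<longrightarrow>
         poly W z * deriv (eps w \<kappa> \<phi> n) z =
           poly (\<Theta> n) z * eps w \<kappa> \<phi> (n+1) z - poly (\<Omega> n - V) z * eps w \<kappa> \<phi> n z \<and>
         poly W z * deriv (eps_star w \<kappa> \<phi>b n) z =
           - poly (\<Theta>s n) z * eps_star w \<kappa> \<phi>b (n+1) z
             + poly (\<Omega>s n + V) z * eps_star w \<kappa> \<phi>b n z))"

end

theory Submission imports Defs begin

text \<open>
  Let \<open>\<phi>*\<^sub>n\<close> be the reversed polynomial. The two columns \<open>(\<phi>\<^sub>n, \<phi>*\<^sub>n)\<close> and \<open>(\<epsilon>\<^sub>n, -\<epsilon>*\<^sub>n)\<close> obey the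
  same Szego recurrences, so that any two of \<open>\<phi>\<^sub>n, \<phi>*\<^sub>n, \<phi>\<^sub>n\<^sub>+\<^sub>1, \<phi>*\<^sub>n\<^sub>+\<^sub>1\<close> express, through the defining
  differential relations, their own derivatives: a pair \<open>(p, q)\<close> of polynomials and the
  corresponding pair \<open>(e, f)\<close> of functions of the second kind satisfy
  \<open>W (p, q)' = (A - V) (p, q)\<close> and \<open>W (e, f)' = (A + V) (e, f)\<close>
  with one and the same polynomial matrix \<open>A\<close>.

  Two facts pin down \<open>A\<close> at a zero \<open>x \<noteq> 0\<close> of \<open>W\<close>. The Casoratian \<open>p f - q e\<close> is a nonzero multiple of
  a power \<open>z\<^sup>k\<close>, because the matrix of the Szego recurrence has determinant \<open>z\<close>; differentiating it
  gives \<open>z tr A = k W\<close>, hence \<open>tr A(x) = 0\<close>. And \<open>W p'\<close> and \<open>W q'\<close> vanish at \<open>x\<close>, so that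
  \<open>(p(x), q(x))\<close>, which is not the zero vector, lies in the kernel of \<open>A(x) - V(x)\<close>; thus
  \<open>det (A(x) - V(x)) = 0\<close>. For a traceless matrix with first row \<open>(a, b)\<close> and second row \<open>(c, -a)\<close>
  this reads \<open>a\<^sup>2 + b c = V\<^sup>2\<close>. This is \<open>singular_point_identity\<close>, and each of the bilinear
  identities is this one equation for one pair: \<open>(\<phi>\<^sub>n, \<phi>\<^sub>n\<^sub>+\<^sub>1)\<close> and \<open>(\<phi>*\<^sub>n, \<phi>*\<^sub>n\<^sub>+\<^sub>1)\<close> for the first two,
  \<open>(\<phi>\<^sub>n, \<phi>*\<^sub>n\<^sub>-\<^sub>1)\<close> and \<open>(\<phi>*\<^sub>n, \<phi>\<^sub>n\<^sub>-\<^sub>1)\<close> for the next two, and \<open>(\<phi>\<^sub>n, \<phi>*\<^sub>n)\<close> for the last.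
  For the last pair, the vanishing of the trace says that the two bracketed expressions agree.

  All relations between analytic functions are used inside the unit disc only. The trace
  relation is an identity of polynomials, and the kernel vector consists of polynomials, so that
  the result reaches every \<open>x\<close>, on the unit circle as well.
\<close>

section \<open>Bounded linear functionals on the unit circle\<close>

text \<open>Integration over the circle against the weight enters only through these properties. They
  are preserved by the substitution \<open>\<zeta> \<mapsto> 1 / \<zeta>\<close>, which exchanges the two families of polynomials.\<close>

locale circle_functional =
  fixes L :: "(complex \<Rightarrow> complex) \<Rightarrow> complex"
  assumes L_cong: "\<And>f g. (\<And>\<zeta>. norm \<zeta> = 1 \<Longrightarrow> f \<zeta> = g \<zeta>) \<Longrightarrow> L f = L g"
    and L_add: "\<And>f g. continuous_on (sphere 0 1) f \<Longrightarrow> continuous_on (sphere 0 1) g \<Longrightarrow>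
      L (\<lambda>\<zeta>. f \<zeta> + g \<zeta>) = L f + L g"
    and L_scale: "\<And>f c. continuous_on (sphere 0 1) f \<Longrightarrow> L (\<lambda>\<zeta>. c * f \<zeta>) = c * L f"
    and L_bounded: "\<exists>C. \<forall>f M. continuous_on (sphere 0 1) f \<longrightarrow>
      (\<forall>\<zeta>\<in>sphere 0 1. norm (f \<zeta>) \<le> M) \<longrightarrow> norm (L f) \<le> C * M"
begin

lemma L_zero: "L (\<lambda>\<zeta>. 0) = 0"
  using L_scale[of "\<lambda>\<zeta>. 0" 0] by simp

lemma L_diff:
  assumes "continuous_on (sphere 0 1) f" "continuous_on (sphere 0 1) g"
  shows "L (\<lambda>\<zeta>. f \<zeta> - g \<zeta>) = L f - L g"
proof -
  have "continuous_on (sphere 0 1) (\<lambda>\<zeta>. (-1) * g \<zeta>)"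
    by (intro continuous_intros assms)
  from L_add[OF assms(1) this] L_scale[OF assms(2), of "-1"] show ?thesis by simp
qed

lemma L_sum:
  assumes "finite A" "\<And>i. i \<in> A \<Longrightarrow> continuous_on (sphere 0 1) (f i)"
  shows "L (\<lambda>\<zeta>. \<Sum>i\<in>A. f i \<zeta>) = (\<Sum>i\<in>A. L (f i))"
  using assms
proof (induction A rule: finite_induct)
  case empty
  then show ?case by (simp add: L_zero)
next
  case (insert i A)
  have "continuous_on (sphere 0 1) (\<lambda>\<zeta>. \<Sum>i\<in>A. f i \<zeta>)"
    using insert.prems by (intro continuous_intros) auto
  with insert show ?case by (simp add: L_add)
qed

text \<open>Boundedness of \<open>L\<close> is what allows differentiation under \<open>L\<close>: the error of the difference
  quotient is \<open>t\<close> times \<open>L\<close> of a kernel that stays bounded on the circle as \<open>t\<close> tends to \<open>0\<close>.\<close>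

lemma cauchy_transform_holomorphic:
  assumes g: "continuous_on (sphere 0 1) g"
  shows "(\<lambda>z. L (\<lambda>\<zeta>. g \<zeta> / (\<zeta> - z))) holomorphic_on ball 0 1"
proof -
  from L_bounded obtain C where C: "\<forall>f M. continuous_on (sphere 0 1) f \<longrightarrow>
      (\<forall>\<zeta>\<in>sphere 0 1. norm (f \<zeta>) \<le> M) \<longrightarrow> norm (L f) \<le> C * M" by blast
  have "bounded (g ` sphere 0 1)"
    by (intro compact_imp_bounded compact_continuous_image g) simp
  then obtain B where "\<forall>x\<in>g ` sphere 0 1. norm x \<le> B"
    unfolding bounded_iff by blast
  then have B: "norm (g \<zeta>) \<le> B" if "norm \<zeta> = 1" for \<zeta>
    using that by simp
  have "B \<ge> 0" using order_trans[OF norm_ge_zero B[of 1]] by simp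
  let ?h = "\<lambda>z. L (\<lambda>\<zeta>. g \<zeta> / (\<zeta> - z))"
  have cont: "continuous_on (sphere 0 1) (\<lambda>\<zeta>. g \<zeta> / (\<zeta> - z))" if "norm z < 1" for z
    using that by (intro continuous_intros g) auto
  have cont2: "continuous_on (sphere 0 1) (\<lambda>\<zeta>. g \<zeta> / (\<zeta> - z)^2)" if "norm z < 1" for z
    using that by (intro continuous_intros g) auto
  have "(?h has_field_derivative L (\<lambda>\<zeta>. g \<zeta> / (\<zeta> - z)^2)) (at z)" if z: "norm z < 1" for z
  proof -
    \<comment> \<open>half the distance from \<open>z\<close> to the circle, so that \<open>z + t\<close> keeps distance \<open>d\<close> for \<open>norm t < d\<close>\<close>
    define d where "d = (1 - norm z) / 2"
    have d: "d > 0" using z by (simp add: d_def)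
    let ?D = "L (\<lambda>\<zeta>. g \<zeta> / (\<zeta> - z)^2)"
    have est: "norm ((?h (z + t) - ?h z) / t - ?D) \<le> norm t * (C * (B / (d * d^2)))"
      if t: "t \<noteq> 0" "norm t < d" for t
    proof -
      have zt: "norm (z + t) < 1"
        using norm_triangle_ineq[of z t] t z by (simp add: d_def field_simps)
      let ?f = "\<lambda>\<zeta>. g \<zeta> / ((\<zeta> - (z + t)) * (\<zeta> - z)^2)"
      have cf: "continuous_on (sphere 0 1) ?f"
        using z zt by (intro continuous_intros g) auto
      have "t * t * L ?f = L (\<lambda>\<zeta>. t * t * ?f \<zeta>)"
        using L_scale[OF cf, of "t * t"] by simp
      also have "\<dots> = L (\<lambda>\<zeta>. (g \<zeta> / (\<zeta> - (z + t)) - g \<zeta> / (\<zeta> - z)) - t * (g \<zeta> / (\<zeta> - z)^2))"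
      proof (rule L_cong)
        fix \<zeta> :: complex assume "norm \<zeta> = 1"
        then have "\<zeta> - z \<noteq> 0" "\<zeta> - (z + t) \<noteq> 0" using z zt by auto
        moreover define u where "u = \<zeta> - z"
        ultimately have "u \<noteq> 0" "u - t \<noteq> 0" "\<zeta> - (z + t) = u - t" by (auto simp: algebra_simps)
        then show "t * t * ?f \<zeta> = (g \<zeta> / (\<zeta> - (z + t)) - g \<zeta> / (\<zeta> - z)) - t * (g \<zeta> / (\<zeta> - z)^2)"
          unfolding u_def[symmetric]
          by (simp add: divide_simps power2_eq_square) (simp add: algebra_simps)
      qed
      also have "\<dots> = (?h (z + t) - ?h z) - t * ?D"
        by (simp only: L_diff L_scale cont[OF z] cont[OF zt] cont2[OF z] continuous_on_diff
            continuous_on_mult_left)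
      finally have "(?h (z + t) - ?h z) / t - ?D = t * L ?f"
        using t by (simp add: field_simps)
      moreover have "norm (L ?f) \<le> C * (B / (d * d^2))"
      proof (rule C[rule_format, OF cf])
        fix \<zeta> :: complex assume "\<zeta> \<in> sphere 0 1"
        then have \<zeta>: "norm \<zeta> = 1" by simp
        have "d \<le> norm (\<zeta> - z)" using norm_triangle_ineq2[of \<zeta> z] \<zeta> z by (simp add: d_def field_simps)
        moreover have "d \<le> norm (\<zeta> - (z + t))"
          using norm_triangle_ineq2[of \<zeta> "z + t"] norm_triangle_ineq[of z t] \<zeta> t
          by (simp add: d_def field_simps)
        ultimately show "norm (?f \<zeta>) \<le> B / (d * d^2)"
          unfolding norm_divide norm_mult norm_power
          using d B[OF \<zeta>] \<open>B \<ge> 0\<close> by (intro frac_le mult_mono power_mono) auto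
      qed
      ultimately show ?thesis
        by (simp add: norm_mult mult_left_mono del: times_divide_eq_right)
    qed
    have "((\<lambda>t. (?h (z + t) - ?h z) / t - ?D) \<longlongrightarrow> 0) (at 0)"
    proof (rule Lim_null_comparison)
      show "\<forall>\<^sub>F t in at 0. norm ((?h (z + t) - ?h z) / t - ?D) \<le> norm t * (C * (B / (d * d^2)))"
        unfolding eventually_at using d est by (intro exI[of _ d]) auto
      show "((\<lambda>t. norm t * (C * (B / (d * d^2)))) \<longlongrightarrow> 0) (at 0)"
        by (intro tendsto_mult_left_zero tendsto_norm_zero tendsto_ident_at)
    qed
    then show ?thesis unfolding DERIV_def by (simp add: LIM_zero_iff)
  qed
  then show ?thesis
    unfolding holomorphic_on_open[OF open_ball] by (intro ballI exI) simp
qed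

end

section \<open>Bi-orthonormal polynomials and their recurrences\<close>

locale biorthonormal_system = circle_functional L for L +
  fixes \<kappa> :: "nat \<Rightarrow> complex" and \<phi> \<phi>b :: "nat \<Rightarrow> complex poly"
  assumes kappa_nonzero: "\<And>n. \<kappa> n \<noteq> 0"
    and degree_phi: "\<And>n. degree (\<phi> n) = n" and coeff_phi: "\<And>n. coeff (\<phi> n) n = \<kappa> n"
    and degree_phib: "\<And>n. degree (\<phi>b n) = n" and coeff_phib: "\<And>n. coeff (\<phi>b n) n = \<kappa> n"
    and orthonormal: "\<And>k n. L (\<lambda>\<zeta>. poly (\<phi> k) \<zeta> * poly (\<phi>b n) (1 / \<zeta>)) = (if k = n then 1 else 0)"
begin

lemma continuous_poly_inverse: "continuous_on (sphere 0 1) (\<lambda>\<zeta>::complex. poly p (1 / \<zeta>))"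
  by (intro continuous_intros) auto

text \<open>Every statement about \<open>\<phi>\<close> thereby has a mirror image about \<open>\<phi>b\<close>.\<close>

lemma dual: "biorthonormal_system (\<lambda>f. L (\<lambda>\<zeta>. f (1 / \<zeta>))) \<kappa> \<phi>b \<phi>"
proof -
  have inv: "continuous_on (sphere 0 1) (\<lambda>\<zeta>. f (1 / \<zeta>))"
    if "continuous_on (sphere 0 1) f" for f :: "complex \<Rightarrow> complex"
    by (rule continuous_on_compose2[OF that]) (auto intro!: continuous_intros simp: norm_divide)
  from L_bounded obtain C where C: "\<forall>f M. continuous_on (sphere 0 1) f \<longrightarrow>
      (\<forall>\<zeta>\<in>sphere 0 1. norm (f \<zeta>) \<le> M) \<longrightarrow> norm (L f) \<le> C * M" by blast
  show ?thesis
  proof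
    show "\<exists>C. \<forall>f M. continuous_on (sphere 0 1) f \<longrightarrow>
      (\<forall>\<zeta>\<in>sphere 0 1. norm (f \<zeta>) \<le> M) \<longrightarrow> norm (L (\<lambda>\<zeta>. f (1 / \<zeta>))) \<le> C * M"
      by (intro exI[of _ C] allI impI C[rule_format] inv) (auto simp: norm_divide)
    show "L (\<lambda>\<zeta>. poly (\<phi>b k) (1 / \<zeta>) * poly (\<phi> n) (1 / (1 / \<zeta>))) = (if k = n then 1 else 0)" for k n
      using orthonormal[of n k] by (simp add: mult.commute)
  qed (auto intro!: L_cong simp: norm_divide L_add L_scale inv kappa_nonzero degree_phi coeff_phi
      degree_phib coeff_phib)
qed

text \<open>The \<open>\<phi>\<^sub>k\<close> with \<open>k < N\<close> span the polynomials of degree below \<open>N\<close>; the induction strips off one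
  leading coefficient at a time.\<close>

lemma pairing_lower:
  assumes "\<And>i. i \<ge> N \<Longrightarrow> coeff p i = 0" "N \<le> n"
  shows "L (\<lambda>\<zeta>. poly p \<zeta> * poly (\<phi>b n) (1 / \<zeta>)) = 0"
  using assms
proof (induction N arbitrary: p)
  case 0
  then have "p = 0" by (intro poly_eqI) auto
  then show ?case by (simp add: L_zero)
next
  case (Suc N)
  define q where "q = p - Polynomial.smult (coeff p N / \<kappa> N) (\<phi> N)"
  have "coeff q i = 0" if "i \<ge> N" for i
    using that Suc.prems(1)[of i] kappa_nonzero[of N] coeff_phi[of N]
      coeff_eq_0[of "\<phi> N" i] degree_phi[of N]
    by (cases "i = N") (auto simp: q_def)
  then have "L (\<lambda>\<zeta>. poly q \<zeta> * poly (\<phi>b n) (1 / \<zeta>)) = 0"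
    using Suc by auto
  moreover have "L (\<lambda>\<zeta>. poly p \<zeta> * poly (\<phi>b n) (1 / \<zeta>)) =
      L (\<lambda>\<zeta>. poly q \<zeta> * poly (\<phi>b n) (1 / \<zeta>) +
        (coeff p N / \<kappa> N) * (poly (\<phi> N) \<zeta> * poly (\<phi>b n) (1 / \<zeta>)))"
    by (rule L_cong) (simp add: q_def algebra_simps)
  moreover have "\<dots> = L (\<lambda>\<zeta>. poly q \<zeta> * poly (\<phi>b n) (1 / \<zeta>)) +
        (coeff p N / \<kappa> N) * L (\<lambda>\<zeta>. poly (\<phi> N) \<zeta> * poly (\<phi>b n) (1 / \<zeta>))"
    by (subst L_add, (intro continuous_intros continuous_poly_inverse)+)
      (subst L_scale, (intro continuous_intros continuous_poly_inverse)+, rule refl)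
  ultimately show ?case using orthonormal[of N n] Suc.prems(2) by simp
qed

lemma pairing_leading:
  assumes "degree p \<le> n"
  shows "L (\<lambda>\<zeta>. poly p \<zeta> * poly (\<phi>b n) (1 / \<zeta>)) = coeff p n / \<kappa> n"
proof -
  define q where "q = p - Polynomial.smult (coeff p n / \<kappa> n) (\<phi> n)"
  have "coeff q i = 0" if "i \<ge> n" for i
    using that assms kappa_nonzero[of n] coeff_phi[of n]
      coeff_eq_0[of "\<phi> n" i] coeff_eq_0[of p i] degree_phi[of n]
    by (cases "i = n") (auto simp: q_def)
  then have "L (\<lambda>\<zeta>. poly q \<zeta> * poly (\<phi>b n) (1 / \<zeta>)) = 0"
    by (rule pairing_lower) auto
  moreover have "L (\<lambda>\<zeta>. poly p \<zeta> * poly (\<phi>b n) (1 / \<zeta>)) =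
      L (\<lambda>\<zeta>. poly q \<zeta> * poly (\<phi>b n) (1 / \<zeta>) +
        (coeff p n / \<kappa> n) * (poly (\<phi> n) \<zeta> * poly (\<phi>b n) (1 / \<zeta>)))"
    by (rule L_cong) (simp add: q_def algebra_simps)
  moreover have "\<dots> = L (\<lambda>\<zeta>. poly q \<zeta> * poly (\<phi>b n) (1 / \<zeta>)) +
        (coeff p n / \<kappa> n) * L (\<lambda>\<zeta>. poly (\<phi> n) \<zeta> * poly (\<phi>b n) (1 / \<zeta>))"
    by (subst L_add, (intro continuous_intros continuous_poly_inverse)+)
      (subst L_scale, (intro continuous_intros continuous_poly_inverse)+, rule refl)
  ultimately show ?thesis using orthonormal[of n n] by simp
qed

lemma pairing_monom_phib:
  assumes "k \<le> n"
  shows "L (\<lambda>\<zeta>. \<zeta> ^ k * poly (\<phi>b n) (1 / \<zeta>)) = (if k = n then 1 / \<kappa> n else 0)"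
proof -
  have "degree (monom 1 k :: complex poly) \<le> n"
    using assms degree_monom_le[of "1::complex" k] by linarith
  from pairing_leading[OF this] show ?thesis by (simp add: poly_monom)
qed

lemma pairing_phi_monom:
  assumes "k \<le> n"
  shows "L (\<lambda>\<zeta>. poly (\<phi> n) \<zeta> / \<zeta> ^ k) = (if k = n then 1 / \<kappa> n else 0)"
  using biorthonormal_system.pairing_monom_phib[OF dual assms]
  by (simp add: power_one_over)

text \<open>Nondegeneracy of the pairing: with \<open>d\<close> the degree of \<open>p\<close>, pairing \<open>p\<close> with \<open>\<phi>b\<^sub>d\<close> detects the leading
  coefficient of \<open>p\<close>, whereas \<open>\<phi>b\<^sub>d(1 / \<zeta>)\<close> is a combination of the powers orthogonal to \<open>p\<close>.\<close>

lemma orthogonal_imp_zero: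
  assumes small: "\<And>i. i \<ge> n \<Longrightarrow> coeff p i = 0"
    and orth: "\<And>k. k < n \<Longrightarrow> L (\<lambda>\<zeta>. poly p \<zeta> / \<zeta> ^ k) = 0"
  shows "p = 0"
proof (rule ccontr)
  assume "p \<noteq> 0"
  define d where "d = degree p"
  have lc: "coeff p d \<noteq> 0" using \<open>p \<noteq> 0\<close> by (simp add: d_def)
  then have "d < n" using small[of d] by (meson not_le)
  have "L (\<lambda>\<zeta>. poly p \<zeta> * poly (\<phi>b d) (1 / \<zeta>)) =
      L (\<lambda>\<zeta>. \<Sum>k\<le>d. coeff (\<phi>b d) k * (poly p \<zeta> / \<zeta> ^ k))"
    by (rule L_cong)
      (simp add: poly_altdef[of "\<phi>b d"] degree_phib sum_distrib_left power_one_over mult_ac)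
  also have "\<dots> = (\<Sum>k\<le>d. L (\<lambda>\<zeta>. coeff (\<phi>b d) k * (poly p \<zeta> / \<zeta> ^ k)))"
    by (rule L_sum) (auto intro!: continuous_intros)
  also have "\<dots> = (\<Sum>k\<le>d. coeff (\<phi>b d) k * L (\<lambda>\<zeta>. poly p \<zeta> / \<zeta> ^ k))"
    by (rule sum.cong[OF refl], rule L_scale) (auto intro!: continuous_intros)
  also have "\<dots> = 0"
    using orth \<open>d < n\<close> by simp
  finally have "coeff p d / \<kappa> d = 0"
    using pairing_leading[of p d] by (simp add: d_def)
  with lc kappa_nonzero[of d] show False by simp
qed

abbreviation phis :: "nat \<Rightarrow> complex poly" where
  "phis n \<equiv> phi_star \<phi>b n"

lemma poly_phis: "\<zeta> \<noteq> 0 \<Longrightarrow> poly (phis n) \<zeta> = \<zeta> ^ n * poly (\<phi>b n) (1 / \<zeta>)"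
  by (simp add: phi_star_def poly_reflect_poly_nz degree_phib inverse_eq_divide)

text \<open>Since \<open>\<phi>*\<^sub>n(\<zeta>) = \<zeta>\<^sup>n \<phi>b\<^sub>n(1 / \<zeta>)\<close> on the circle, \<open>\<phi>*\<^sub>n\<close> is orthogonal to \<open>\<zeta>, \<dots>, \<zeta>\<^sup>n\<close>, where \<open>\<phi>\<^sub>n\<close> is
  orthogonal to \<open>1, \<dots>, \<zeta>\<^sup>n\<^sup>-\<^sup>1\<close>.\<close>

lemma pairing_phis_monom:
  assumes "k \<le> n"
  shows "L (\<lambda>\<zeta>. poly (phis n) \<zeta> / \<zeta> ^ k) = (if k = 0 then 1 / \<kappa> n else 0)"
proof -
  have "L (\<lambda>\<zeta>. poly (phis n) \<zeta> / \<zeta> ^ k) = L (\<lambda>\<zeta>. \<zeta> ^ (n - k) * poly (\<phi>b n) (1 / \<zeta>))"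
  proof (rule L_cong)
    fix \<zeta> :: complex assume "norm \<zeta> = 1"
    then have "\<zeta> \<noteq> 0" by auto
    with assms show "poly (phis n) \<zeta> / \<zeta> ^ k = \<zeta> ^ (n - k) * poly (\<phi>b n) (1 / \<zeta>)"
      by (simp add: poly_phis power_diff)
  qed
  with pairing_monom_phib[of "n - k" n] assms show ?thesis by auto
qed

lemma coeff_phis_0: "coeff (phis n) 0 = \<kappa> n"
  by (simp add: phi_star_def coeff_phib degree_phib)

lemma coeff_phis_gt: "i > n \<Longrightarrow> coeff (phis n) i = 0"
  using degree_reflect_poly_le[of "\<phi>b n"] by (intro coeff_eq_0) (auto simp: phi_star_def degree_phib)

abbreviation r :: "nat \<Rightarrow> complex" where "r n \<equiv> poly (\<phi> n) 0"
abbreviation rb :: "nat \<Rightarrow> complex" where "rb n \<equiv> poly (\<phi>b n) 0"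

text \<open>In the difference of the two sides the coefficients of \<open>z\<^sup>n\<^sup>+\<^sup>1\<close> and of \<open>1\<close> cancel, and all three terms
  are orthogonal to \<open>\<zeta>, \<dots>, \<zeta>\<^sup>n\<close>. So the difference is \<open>z q\<close> with \<open>q\<close> of degree below \<open>n\<close> and orthogonal
  to \<open>1, \<dots>, \<zeta>\<^sup>n\<^sup>-\<^sup>1\<close>.\<close>

lemma szego_phi:
  "\<kappa> n * poly (\<phi> (Suc n)) z = \<kappa> (Suc n) * z * poly (\<phi> n) z + r (Suc n) * poly (phis n) z"
proof -
  define p where "p = Polynomial.smult (\<kappa> n) (\<phi> (Suc n)) - Polynomial.smult (\<kappa> (Suc n)) (pCons 0 (\<phi> n))
    - Polynomial.smult (r (Suc n)) (phis n)"
  obtain c q where pq: "p = pCons c q" by (cases p)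
  have "c = coeff p 0" by (simp add: pq)
  also have "\<dots> = 0" by (simp add: p_def coeff_phis_0 poly_0_coeff_0)
  finally have p: "p = pCons 0 q" by (simp add: pq)
  have "q = 0"
  proof (rule orthogonal_imp_zero)
    fix i assume i: "i \<ge> n"
    have "coeff q i = coeff p (Suc i)" by (simp add: p)
    also have "\<dots> = 0"
      using i coeff_eq_0[of "\<phi> (Suc n)" "Suc i"] coeff_eq_0[of "\<phi> n" i]
      by (cases "i = n") (auto simp: p_def degree_phi coeff_phi coeff_phis_gt)
    finally show "coeff q i = 0" .
  next
    fix k assume k: "k < n"
    have "L (\<lambda>\<zeta>. poly q \<zeta> / \<zeta> ^ k) =
      L (\<lambda>\<zeta>. \<kappa> n * (poly (\<phi> (Suc n)) \<zeta> / \<zeta> ^ Suc k) - \<kappa> (Suc n) * (poly (\<phi> n) \<zeta> / \<zeta> ^ k)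
         - r (Suc n) * (poly (phis n) \<zeta> / \<zeta> ^ Suc k))"
    proof (rule L_cong)
      fix \<zeta> :: complex assume "norm \<zeta> = 1"
      then have z: "\<zeta> \<noteq> 0" by auto
      have "\<zeta> * poly q \<zeta> = poly p \<zeta>" by (simp add: p)
      then have "poly q \<zeta> = poly p \<zeta> / \<zeta>" using z by (simp add: field_simps)
      then show "poly q \<zeta> / \<zeta> ^ k = \<kappa> n * (poly (\<phi> (Suc n)) \<zeta> / \<zeta> ^ Suc k)
          - \<kappa> (Suc n) * (poly (\<phi> n) \<zeta> / \<zeta> ^ k) - r (Suc n) * (poly (phis n) \<zeta> / \<zeta> ^ Suc k)"
        using z by (simp add: p_def diff_divide_distrib add_divide_distrib)
    qed
    also have "\<dots> = \<kappa> n * L (\<lambda>\<zeta>. poly (\<phi> (Suc n)) \<zeta> / \<zeta> ^ Suc k)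
       - \<kappa> (Suc n) * L (\<lambda>\<zeta>. poly (\<phi> n) \<zeta> / \<zeta> ^ k)
       - r (Suc n) * L (\<lambda>\<zeta>. poly (phis n) \<zeta> / \<zeta> ^ Suc k)"
    proof -
      have c: "continuous_on (sphere 0 1) (\<lambda>\<zeta>::complex. poly p \<zeta> / \<zeta> ^ k)" for p k
        by (intro continuous_intros) auto
      show ?thesis
        by (simp only: L_diff L_scale c continuous_on_diff continuous_on_mult_left)
    qed
    also have "\<dots> = 0"
      using k pairing_phi_monom[of "Suc k" "Suc n"] pairing_phi_monom[of k n]
        pairing_phis_monom[of "Suc k" n] by simp
    finally show "L (\<lambda>\<zeta>. poly q \<zeta> / \<zeta> ^ k) = 0" .
  qed
  then have "poly p z = 0" by (simp add: p)
  then show ?thesis by (simp add: p_def algebra_simps)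
qed

text \<open>The reversal of the dual of \<open>szego_phi\<close>; reversing needs \<open>z \<noteq> 0\<close>, and the point \<open>0\<close> follows because
  both sides are polynomials.\<close>

lemma szego_phis:
  "\<kappa> n * poly (phis (Suc n)) z = \<kappa> (Suc n) * poly (phis n) z + rb (Suc n) * z * poly (\<phi> n) z"
proof -
  have nz: "\<kappa> n * poly (phis (Suc n)) z = \<kappa> (Suc n) * poly (phis n) z + rb (Suc n) * z * poly (\<phi> n) z"
    if z: "z \<noteq> 0" for z
  proof -
    have "\<kappa> n * poly (\<phi>b (Suc n)) (1/z) = \<kappa> (Suc n) * (1/z) * poly (\<phi>b n) (1/z)
        + rb (Suc n) * poly (phi_star \<phi> n) (1/z)"
      by (rule biorthonormal_system.szego_phi[OF dual])
    moreover have "poly (phi_star \<phi> n) (1/z) = poly (\<phi> n) z / z ^ n"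
      using z by (simp add: phi_star_def poly_reflect_poly_nz degree_phi inverse_eq_divide power_one_over)
    ultimately have "z ^ Suc n * (\<kappa> n * poly (\<phi>b (Suc n)) (1/z)) =
        z ^ Suc n * (\<kappa> (Suc n) * (1/z) * poly (\<phi>b n) (1/z) + rb (Suc n) * (poly (\<phi> n) z / z ^ n))"
      by simp
    also have "\<dots> = \<kappa> (Suc n) * (z ^ n * poly (\<phi>b n) (1/z)) + rb (Suc n) * z * poly (\<phi> n) z"
      using z by (simp add: distrib_left)
    finally show ?thesis using z by (simp add: poly_phis mult_ac)
  qed
  let ?p = "Polynomial.smult (\<kappa> n) (phis (Suc n)) - Polynomial.smult (\<kappa> (Suc n)) (phis n) - Polynomial.smult (rb (Suc n)) (pCons 0 (\<phi> n))"
  have "poly ?p z = 0" if "z \<noteq> 0" for z using nz[OF that] by (simp add: algebra_simps)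
  then have "UNIV - {0} \<subseteq> {z. poly ?p z = 0}" by auto
  moreover have "infinite (UNIV - {0::complex})" by (simp add: infinite_UNIV_char_0)
  ultimately have "?p = 0" using poly_roots_finite[of ?p] finite_subset by blast
  then have "poly ?p z = 0" by simp
  then show ?thesis by (simp add: algebra_simps)
qed

text \<open>Eliminating \<open>z \<phi>\<^sub>n\<close> from the two recurrences leaves a relation between \<open>\<phi>*\<^sub>n\<close>, \<open>\<phi>*\<^sub>n\<^sub>+\<^sub>1\<close> and \<open>\<phi>\<^sub>n\<^sub>+\<^sub>1\<close>,
  whose means over the circle are \<open>1 / \<kappa>\<^sub>n\<close>, \<open>1 / \<kappa>\<^sub>n\<^sub>+\<^sub>1\<close> and \<open>0\<close>. In other words, the matrix of the
  recurrence has determinant \<open>z\<close>.\<close>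

lemma kappa_square: "(\<kappa> (Suc n))\<^sup>2 = (\<kappa> n)\<^sup>2 + r (Suc n) * rb (Suc n)"
proof -
  let ?K = "(\<kappa> (Suc n))\<^sup>2 - r (Suc n) * rb (Suc n)"
  have c: "continuous_on (sphere 0 1) (\<lambda>\<zeta>::complex. poly p \<zeta>)" for p
    by (intro continuous_intros)
  have "L (\<lambda>\<zeta>. ?K * poly (phis n) \<zeta>) =
     L (\<lambda>\<zeta>. \<kappa> n * \<kappa> (Suc n) * poly (phis (Suc n)) \<zeta> - \<kappa> n * rb (Suc n) * poly (\<phi> (Suc n)) \<zeta>)"
  proof (rule L_cong)
    fix \<zeta> :: complex
    have "\<kappa> n * \<kappa> (Suc n) * poly (phis (Suc n)) \<zeta> - \<kappa> n * rb (Suc n) * poly (\<phi> (Suc n)) \<zeta> =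
       \<kappa> (Suc n) * (\<kappa> n * poly (phis (Suc n)) \<zeta>) - rb (Suc n) * (\<kappa> n * poly (\<phi> (Suc n)) \<zeta>)"
      by (simp add: algebra_simps)
    also have "\<dots> = ?K * poly (phis n) \<zeta>"
      unfolding szego_phi szego_phis by (simp add: algebra_simps power2_eq_square)
    finally show "?K * poly (phis n) \<zeta> =
      \<kappa> n * \<kappa> (Suc n) * poly (phis (Suc n)) \<zeta> - \<kappa> n * rb (Suc n) * poly (\<phi> (Suc n)) \<zeta>" ..
  qed
  then have "?K * L (poly (phis n)) =
      \<kappa> n * \<kappa> (Suc n) * L (poly (phis (Suc n))) - \<kappa> n * rb (Suc n) * L (poly (\<phi> (Suc n)))"
    by (simp only: L_diff L_scale c continuous_on_diff continuous_on_mult_left)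
  then have "?K / \<kappa> n = \<kappa> n"
    using pairing_phis_monom[of 0 n] pairing_phis_monom[of 0 "Suc n"] pairing_phi_monom[of 0 "Suc n"]
      kappa_nonzero by simp
  then show ?thesis using kappa_nonzero[of n] by (simp add: field_simps power2_eq_square)
qed

text \<open>For \<open>z \<noteq> 0\<close> the recurrence can be inverted, so a common zero would descend to the nonzero
  constants \<open>\<phi>\<^sub>0\<close> and \<open>\<phi>*\<^sub>0\<close>.\<close>

lemma phi_phis_no_common_zero:
  assumes "z \<noteq> 0"
  shows "poly (\<phi> n) z \<noteq> 0 \<or> poly (phis n) z \<noteq> 0"
proof (induction n)
  case 0
  have "\<phi> 0 = [:\<kappa> 0:]"
    using degree_phi[of 0] coeff_phi[of 0] by (metis degree_0_id)
  then show ?case using kappa_nonzero[of 0] by simp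
next
  case (Suc n)
  show ?case
  proof (rule ccontr)
    assume "\<not> ?thesis"
    then have a: "\<kappa> (Suc n) * z * poly (\<phi> n) z + r (Suc n) * poly (phis n) z = 0"
      and b: "\<kappa> (Suc n) * poly (phis n) z + rb (Suc n) * z * poly (\<phi> n) z = 0"
      using szego_phi[of n z] szego_phis[of n z] by auto
    have "(\<kappa> n)\<^sup>2 * poly (phis n) z = ((\<kappa> (Suc n))\<^sup>2 - r (Suc n) * rb (Suc n)) * poly (phis n) z"
      by (simp add: kappa_square)
    also have "\<dots> = \<kappa> (Suc n) * (\<kappa> (Suc n) * poly (phis n) z + rb (Suc n) * z * poly (\<phi> n) z)
        - rb (Suc n) * (\<kappa> (Suc n) * z * poly (\<phi> n) z + r (Suc n) * poly (phis n) z)"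
      by (simp add: algebra_simps power2_eq_square)
    finally have 1: "poly (phis n) z = 0" using a b kappa_nonzero[of n] by simp
    with a have "poly (\<phi> n) z = 0" using kappa_nonzero[of "Suc n"] assms by simp
    with 1 Suc.IH show False by blast
  qed
qed

section \<open>The functions of the second kind\<close>

text \<open>These are \<open>\<epsilon>\<^sub>n\<close> and \<open>-\<epsilon>*\<^sub>n\<close>, with the Herglotz kernel \<open>(\<zeta> + z) / (\<zeta> - z)\<close> replaced by
  \<open>(\<zeta> + z) / (\<zeta> - z) + 1\<close> and \<open>(\<zeta> + z) / (\<zeta> - z) - 1\<close>, and with \<open>\<phi>*\<^sub>n(\<zeta>)\<close> in place of \<open>z\<^sup>n \<phi>b\<^sub>n(1 / \<zeta>)\<close>. By
  orthogonality neither change affects the value for \<open>n \<ge> 1\<close>, while for \<open>n = 0\<close> the shift of the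
  kernel produces exactly the additional terms \<open>1 / \<kappa>\<^sub>0\<close>. In this form the case \<open>n = 0\<close> is not
  special and the Szego recurrences carry over by linearity.\<close>

definition second_kind :: "nat \<Rightarrow> complex \<Rightarrow> complex" where
  "second_kind n z = L (\<lambda>\<zeta>. 2 * \<zeta> * poly (\<phi> n) \<zeta> / (\<zeta> - z))"

definition second_kind_star :: "nat \<Rightarrow> complex \<Rightarrow> complex" where
  "second_kind_star n z = z * L (\<lambda>\<zeta>. 2 * poly (phis n) \<zeta> / (\<zeta> - z))"

lemma second_kind_holomorphic: "second_kind n holomorphic_on ball 0 1"
  unfolding second_kind_def by (intro cauchy_transform_holomorphic continuous_intros)

lemma second_kind_star_holomorphic: "second_kind_star n holomorphic_on ball 0 1"
  unfolding second_kind_star_def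
  by (intro holomorphic_on_mult cauchy_transform_holomorphic continuous_intros holomorphic_on_ident)

text \<open>The kernels \<open>2 \<zeta> / (\<zeta> - z)\<close> and \<open>2 z / (\<zeta> - z)\<close> differ by the constant \<open>2\<close>, and the mean of \<open>\<phi>\<^sub>n\<^sub>+\<^sub>1\<close>
  vanishes.\<close>

lemma second_kind_Suc:
  "second_kind (Suc n) z = z * L (\<lambda>\<zeta>. 2 * poly (\<phi> (Suc n)) \<zeta> / (\<zeta> - z))" if z: "norm z < 1"
proof -
  have "second_kind (Suc n) z = L (\<lambda>\<zeta>. 2 * (poly (\<phi> (Suc n)) \<zeta> / \<zeta> ^ 0)
      + z * (2 * poly (\<phi> (Suc n)) \<zeta> / (\<zeta> - z)))"
    unfolding second_kind_def
  proof (rule L_cong)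
    fix \<zeta> :: complex assume "norm \<zeta> = 1"
    then have "\<zeta> - z \<noteq> 0" using z by auto
    then show "2 * \<zeta> * poly (\<phi> (Suc n)) \<zeta> / (\<zeta> - z) =
        2 * (poly (\<phi> (Suc n)) \<zeta> / \<zeta> ^ 0) + z * (2 * poly (\<phi> (Suc n)) \<zeta> / (\<zeta> - z))"
      by (simp add: field_simps)
  qed
  also have "\<dots> = 2 * L (\<lambda>\<zeta>. poly (\<phi> (Suc n)) \<zeta> / \<zeta> ^ 0)
      + z * L (\<lambda>\<zeta>. 2 * poly (\<phi> (Suc n)) \<zeta> / (\<zeta> - z))"
  proof -
    have c: "continuous_on (sphere 0 1) (\<lambda>\<zeta>::complex. poly (\<phi> (Suc n)) \<zeta> / \<zeta> ^ 0)"
      "continuous_on (sphere 0 1) (\<lambda>\<zeta>. 2 * poly (\<phi> (Suc n)) \<zeta> / (\<zeta> - z))"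
      using z by (auto intro!: continuous_intros)
    show ?thesis by (simp only: L_add L_scale c continuous_on_mult_left)
  qed
  also have "L (\<lambda>\<zeta>. poly (\<phi> (Suc n)) \<zeta> / \<zeta> ^ 0) = 0"
    by (subst pairing_phi_monom) auto
  finally show ?thesis by simp
qed

lemma L_linear_kernel:
  assumes z: "norm z < 1" and lin: "\<And>\<zeta>. a * p \<zeta> = b * q \<zeta> + c * s \<zeta>"
    and "continuous_on (sphere 0 1) p" "continuous_on (sphere 0 1) q" "continuous_on (sphere 0 1) s"
  shows "a * L (\<lambda>\<zeta>. 2 * p \<zeta> / (\<zeta> - z)) = b * L (\<lambda>\<zeta>. 2 * q \<zeta> / (\<zeta> - z)) + c * L (\<lambda>\<zeta>. 2 * s \<zeta> / (\<zeta> - z))"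
proof -
  have c: "continuous_on (sphere 0 1) (\<lambda>\<zeta>. 2 * f \<zeta> / (\<zeta> - z))" if "continuous_on (sphere 0 1) f" for f
    using z that by (intro continuous_intros) auto
  have "a * L (\<lambda>\<zeta>. 2 * p \<zeta> / (\<zeta> - z)) = L (\<lambda>\<zeta>. a * (2 * p \<zeta> / (\<zeta> - z)))"
    by (simp only: L_scale c assms)
  also have "\<dots> = L (\<lambda>\<zeta>. b * (2 * q \<zeta> / (\<zeta> - z)) + c * (2 * s \<zeta> / (\<zeta> - z)))"
  proof (rule L_cong)
    fix \<zeta>
    have "a * (2 * p \<zeta> / (\<zeta> - z)) = 2 * (a * p \<zeta>) / (\<zeta> - z)" by simp
    also have "\<dots> = b * (2 * q \<zeta> / (\<zeta> - z)) + c * (2 * s \<zeta> / (\<zeta> - z))"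
      unfolding lin by (simp add: algebra_simps add_divide_distrib)
    finally show "a * (2 * p \<zeta> / (\<zeta> - z)) = b * (2 * q \<zeta> / (\<zeta> - z)) + c * (2 * s \<zeta> / (\<zeta> - z))" .
  qed
  also have "\<dots> = b * L (\<lambda>\<zeta>. 2 * q \<zeta> / (\<zeta> - z)) + c * L (\<lambda>\<zeta>. 2 * s \<zeta> / (\<zeta> - z))"
    by (simp only: L_add L_scale c assms continuous_on_mult_left)
  finally show ?thesis .
qed

lemma szego_second_kind:
  assumes z: "norm z < 1"
  shows "\<kappa> n * second_kind (Suc n) z = \<kappa> (Suc n) * z * second_kind n z + r (Suc n) * second_kind_star n z"
proof -
  have "\<kappa> n * L (\<lambda>\<zeta>. 2 * poly (\<phi> (Suc n)) \<zeta> / (\<zeta> - z)) =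
      \<kappa> (Suc n) * L (\<lambda>\<zeta>. 2 * (\<zeta> * poly (\<phi> n) \<zeta>) / (\<zeta> - z)) + r (Suc n) * L (\<lambda>\<zeta>. 2 * poly (phis n) \<zeta> / (\<zeta> - z))"
    by (rule L_linear_kernel[OF z]) (auto intro!: continuous_intros simp: szego_phi)
  from arg_cong[OF this, of "\<lambda>t. z * t"] show ?thesis
    unfolding second_kind_Suc[OF z]
    by (simp add: second_kind_def second_kind_star_def algebra_simps)
qed

lemma szego_second_kind_star:
  assumes z: "norm z < 1"
  shows "\<kappa> n * second_kind_star (Suc n) z = \<kappa> (Suc n) * second_kind_star n z + rb (Suc n) * z * second_kind n z"
proof -
  have "\<kappa> n * L (\<lambda>\<zeta>. 2 * poly (phis (Suc n)) \<zeta> / (\<zeta> - z)) =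
      \<kappa> (Suc n) * L (\<lambda>\<zeta>. 2 * poly (phis n) \<zeta> / (\<zeta> - z)) + rb (Suc n) * L (\<lambda>\<zeta>. 2 * (\<zeta> * poly (\<phi> n) \<zeta>) / (\<zeta> - z))"
    by (rule L_linear_kernel[OF z]) (auto intro!: continuous_intros simp: szego_phis)
  from arg_cong[OF this, of "\<lambda>t. z * t"] show ?thesis
    by (simp add: second_kind_def second_kind_star_def algebra_simps)
qed

text \<open>The recurrence multiplies the Casoratian by its determinant \<open>z\<close>.\<close>

lemma casoratian:
  assumes z: "norm z < 1"
  shows "poly (\<phi> n) z * second_kind_star n z - poly (phis n) z * second_kind n z = - 2 * z ^ n"
proof (induction n)
  case 0
  have p0: "\<phi> 0 = [:\<kappa> 0:]" "\<phi>b 0 = [:\<kappa> 0:]"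
    using degree_phi[of 0] coeff_phi[of 0] degree_phib[of 0] coeff_phib[of 0] by (metis degree_0_id)+
  then have s0: "phis 0 = [:\<kappa> 0:]" by (simp add: phi_star_def)
  have k0: "\<kappa> 0 * L (\<lambda>\<zeta>. \<kappa> 0) = 1"
    using pairing_phi_monom[of 0 0] kappa_nonzero[of 0] by (simp add: p0)
  have c: "continuous_on (sphere 0 1) (\<lambda>\<zeta>. 2 * \<zeta> * \<kappa> 0 / (\<zeta> - z))"
       "continuous_on (sphere 0 1) (\<lambda>\<zeta>. 2 * \<kappa> 0 / (\<zeta> - z))"
    using z by (auto intro!: continuous_intros)
  have "second_kind_star 0 z - second_kind 0 z
      = L (\<lambda>\<zeta>. z * (2 * \<kappa> 0 / (\<zeta> - z)) - 2 * \<zeta> * \<kappa> 0 / (\<zeta> - z))"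
    by (simp only: second_kind_def second_kind_star_def p0 s0 poly_pCons poly_0 mult_zero_right
        add_0_right L_diff L_scale c continuous_on_mult_left)
  also have "\<dots> = L (\<lambda>\<zeta>. (- 2) * \<kappa> 0)"
  proof (rule L_cong)
    fix \<zeta> :: complex assume "norm \<zeta> = 1"
    then have "\<zeta> - z \<noteq> 0" using z by auto
    then show "z * (2 * \<kappa> 0 / (\<zeta> - z)) - 2 * \<zeta> * \<kappa> 0 / (\<zeta> - z) = (- 2) * \<kappa> 0"
      by (simp add: divide_simps) (simp add: algebra_simps)
  qed
  also have "\<dots> = (- 2) * L (\<lambda>\<zeta>. \<kappa> 0)"
    by (rule L_scale) (rule continuous_on_const)
  finally have "\<kappa> 0 * (second_kind_star 0 z - second_kind 0 z) = - 2" using k0 by simp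
  then show ?case by (simp add: p0 s0 algebra_simps)
next
  case (Suc n)
  have "(\<kappa> n)\<^sup>2 * (poly (\<phi> (Suc n)) z * second_kind_star (Suc n) z - poly (phis (Suc n)) z * second_kind (Suc n) z)
     = (\<kappa> n * poly (\<phi> (Suc n)) z) * (\<kappa> n * second_kind_star (Suc n) z)
      - (\<kappa> n * poly (phis (Suc n)) z) * (\<kappa> n * second_kind (Suc n) z)"
    by (simp add: algebra_simps power2_eq_square)
  also have "\<dots> = z * ((\<kappa> (Suc n))\<^sup>2 - r (Suc n) * rb (Suc n)) *
      (poly (\<phi> n) z * second_kind_star n z - poly (phis n) z * second_kind n z)"
    unfolding szego_phi szego_phis szego_second_kind[OF z] szego_second_kind_star[OF z]
    by (simp add: algebra_simps power2_eq_square)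
  also have "\<dots> = (\<kappa> n)\<^sup>2 * (- 2 * z ^ Suc n)"
    unfolding Suc.IH kappa_square by simp
  finally show ?case using kappa_nonzero[of n] by (metis mult_left_cancel power_not_zero)
qed

lemma second_kind_eq_herglotz:
  assumes z: "norm z < 1"
  shows "second_kind n z = (if n = 0 then 1 / \<kappa> 0 + \<kappa> 0 * L (\<lambda>\<zeta>. (\<zeta> + z) / (\<zeta> - z))
     else L (\<lambda>\<zeta>. (\<zeta> + z) / (\<zeta> - z) * poly (\<phi> n) \<zeta>))"
proof -
  have c: "continuous_on (sphere 0 1) (\<lambda>\<zeta>. (\<zeta> + z) / (\<zeta> - z))"
    using z by (auto intro!: continuous_intros)
  from c have c1: "continuous_on (sphere 0 1) (\<lambda>\<zeta>. (\<zeta> + z) / (\<zeta> - z) * poly (\<phi> n) \<zeta>)"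
    by (intro continuous_on_mult continuous_on_poly continuous_on_id)
  have c2: "continuous_on (sphere 0 1) (\<lambda>\<zeta>. poly (\<phi> n) \<zeta> / \<zeta> ^ 0)"
    by (auto intro!: continuous_intros)
  have "second_kind n z = L (\<lambda>\<zeta>. poly (\<phi> n) \<zeta> / \<zeta> ^ 0 + (\<zeta> + z) / (\<zeta> - z) * poly (\<phi> n) \<zeta>)"
    unfolding second_kind_def
  proof (rule L_cong)
    fix \<zeta> :: complex assume "norm \<zeta> = 1"
    then have "\<zeta> - z \<noteq> 0" using z by auto
    then show "2 * \<zeta> * poly (\<phi> n) \<zeta> / (\<zeta> - z) =
        poly (\<phi> n) \<zeta> / \<zeta> ^ 0 + (\<zeta> + z) / (\<zeta> - z) * poly (\<phi> n) \<zeta>"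
      by (simp add: field_simps)
  qed
  also have "\<dots> = L (\<lambda>\<zeta>. poly (\<phi> n) \<zeta> / \<zeta> ^ 0) + L (\<lambda>\<zeta>. (\<zeta> + z) / (\<zeta> - z) * poly (\<phi> n) \<zeta>)"
    by (rule L_add[OF c2 c1])
  also have "L (\<lambda>\<zeta>. poly (\<phi> n) \<zeta> / \<zeta> ^ 0) = (if n = 0 then 1 / \<kappa> n else 0)"
    using pairing_phi_monom[of 0 n] by auto
  finally have main: "second_kind n z =
    (if n = 0 then 1 / \<kappa> n else 0) + L (\<lambda>\<zeta>. (\<zeta> + z) / (\<zeta> - z) * poly (\<phi> n) \<zeta>)" .
  show ?thesis
  proof (cases "n = 0")
    case True
    have "\<phi> 0 = [:\<kappa> 0:]"
      using degree_phi[of 0] coeff_phi[of 0] by (metis degree_0_id)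
    then have "L (\<lambda>\<zeta>. (\<zeta> + z) / (\<zeta> - z) * poly (\<phi> 0) \<zeta>) = \<kappa> 0 * L (\<lambda>\<zeta>. (\<zeta> + z) / (\<zeta> - z))"
      by (simp add: L_scale[OF c, symmetric] mult.commute)
    with main True show ?thesis by simp
  qed (use main in simp)
qed

text \<open>Passing from \<open>\<phi>*\<^sub>n(\<zeta>)\<close> to \<open>z\<^sup>n \<phi>b\<^sub>n(1 / \<zeta>) = (z / \<zeta>)\<^sup>n \<phi>*\<^sub>n(\<zeta>)\<close> under the Cauchy kernel costs a geometric
  sum in \<open>z / \<zeta>\<close>, all of whose terms are killed by the orthogonality of \<open>\<phi>*\<^sub>n\<close> to \<open>\<zeta>, \<dots>, \<zeta>\<^sup>n\<close>.\<close>

lemma second_kind_star_eq_herglotz: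
  assumes z: "norm z < 1"
  shows "second_kind_star n z = (if n = 0 then - (1 / \<kappa> 0 - \<kappa> 0 * L (\<lambda>\<zeta>. (\<zeta> + z) / (\<zeta> - z)))
     else z ^ n * L (\<lambda>\<zeta>. (\<zeta> + z) / (\<zeta> - z) * poly (\<phi>b n) (1 / \<zeta>)))"
proof -
  have c: "continuous_on (sphere 0 1) (\<lambda>\<zeta>. (\<zeta> + z) / (\<zeta> - z))"
    using z by (auto intro!: continuous_intros)
  from c have c1: "continuous_on (sphere 0 1) (\<lambda>\<zeta>. z ^ n * ((\<zeta> + z) / (\<zeta> - z) * poly (\<phi>b n) (1 / \<zeta>)))"
    by (intro continuous_on_mult continuous_on_const continuous_poly_inverse)
  have cs: "continuous_on (sphere 0 1) (\<lambda>\<zeta>. poly (phis n) \<zeta> / \<zeta> ^ k)" for k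
    by (auto intro!: continuous_intros)
  have ck: "continuous_on (sphere 0 1) (\<lambda>\<zeta>. 2 * poly (phis n) \<zeta> / (\<zeta> - z))"
    using z by (auto intro!: continuous_intros)
  have "second_kind_star n z = L (\<lambda>\<zeta>. z * (2 * poly (phis n) \<zeta> / (\<zeta> - z)))"
    unfolding second_kind_star_def by (rule L_scale[OF ck, symmetric])
  also have "\<dots> = L (\<lambda>\<zeta>. z ^ n * ((\<zeta> + z) / (\<zeta> - z) * poly (\<phi>b n) (1 / \<zeta>))
      - z ^ n * (poly (phis n) \<zeta> / \<zeta> ^ n)
      + (\<Sum>i<n. 2 * z ^ Suc i * (poly (phis n) \<zeta> / \<zeta> ^ Suc i)))"
  proof (rule L_cong)
    fix \<zeta> :: complex assume "norm \<zeta> = 1"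
    then have nz: "\<zeta> - z \<noteq> 0" "\<zeta> \<noteq> 0" using z by auto
    define q where "q = z / \<zeta>"
    have q: "1 - q \<noteq> 0" "z = q * \<zeta>" using nz by (auto simp: q_def field_simps)
    let ?P = "poly (phis n) \<zeta>"
    have P: "poly (\<phi>b n) (1 / \<zeta>) = ?P / \<zeta> ^ n"
      using nz by (simp add: poly_phis)
    have k: "\<zeta> - z = \<zeta> * (1 - q)" "\<zeta> + z = \<zeta> * (1 + q)" by (simp_all add: q algebra_simps)
    have "(\<Sum>i<n. 2 * z ^ Suc i * (?P / \<zeta> ^ Suc i)) = 2 * q * ?P * (\<Sum>i<n. q ^ i)"
      unfolding sum_distrib_left by (intro sum.cong) (simp_all add: q_def power_divide)
    also have "(\<Sum>i<n. q ^ i) = (1 - q ^ n) / (1 - q)"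
      using q(1) by (simp add: sum_gp_strict)
    finally have "(\<Sum>i<n. 2 * z ^ Suc i * (?P / \<zeta> ^ Suc i)) = 2 * q * ?P * ((1 - q ^ n) / (1 - q))" .
    moreover have "z ^ n * ((\<zeta> + z) / (\<zeta> - z) * poly (\<phi>b n) (1 / \<zeta>)) = q ^ n * ((1 + q) / (1 - q) * ?P)"
      unfolding k P using nz by (simp add: q_def power_divide)
    moreover have "z ^ n * (?P / \<zeta> ^ n) = q ^ n * ?P" by (simp add: q_def power_divide)
    moreover have "z * (2 * ?P / (\<zeta> - z)) = 2 * q * ?P / (1 - q)"
      unfolding k using nz by (simp add: q_def)
    moreover have "2 * q * ?P / (1 - q) =
       q ^ n * ((1 + q) / (1 - q) * ?P) - q ^ n * ?P + 2 * q * ?P * ((1 - q ^ n) / (1 - q))"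
      using q(1) by (simp add: divide_simps) (simp add: algebra_simps)
    ultimately show "z * (2 * ?P / (\<zeta> - z)) =
      z ^ n * ((\<zeta> + z) / (\<zeta> - z) * poly (\<phi>b n) (1 / \<zeta>)) - z ^ n * (?P / \<zeta> ^ n)
      + (\<Sum>i<n. 2 * z ^ Suc i * (?P / \<zeta> ^ Suc i))" by simp
  qed
  also have "\<dots> = L (\<lambda>\<zeta>. z ^ n * ((\<zeta> + z) / (\<zeta> - z) * poly (\<phi>b n) (1 / \<zeta>)))
      - L (\<lambda>\<zeta>. z ^ n * (poly (phis n) \<zeta> / \<zeta> ^ n))
      + L (\<lambda>\<zeta>. \<Sum>i<n. 2 * z ^ Suc i * (poly (phis n) \<zeta> / \<zeta> ^ Suc i))"
    by (simp only: L_add L_diff cs c1 continuous_on_diff continuous_on_mult_left continuous_on_sum)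
  also have "L (\<lambda>\<zeta>. z ^ n * (poly (phis n) \<zeta> / \<zeta> ^ n)) = z ^ n * L (\<lambda>\<zeta>. poly (phis n) \<zeta> / \<zeta> ^ n)"
    by (rule L_scale[OF cs])
  also have "L (\<lambda>\<zeta>. \<Sum>i<n. 2 * z ^ Suc i * (poly (phis n) \<zeta> / \<zeta> ^ Suc i)) =
      (\<Sum>i<n. 2 * z ^ Suc i * L (\<lambda>\<zeta>. poly (phis n) \<zeta> / \<zeta> ^ Suc i))"
    by (simp only: L_sum L_scale cs continuous_on_mult_left finite_lessThan)
  also have "\<dots> = 0"
    by (simp add: pairing_phis_monom del: power_Suc)
  also have "L (\<lambda>\<zeta>. z ^ n * ((\<zeta> + z) / (\<zeta> - z) * poly (\<phi>b n) (1 / \<zeta>))) =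
      z ^ n * L (\<lambda>\<zeta>. (\<zeta> + z) / (\<zeta> - z) * poly (\<phi>b n) (1 / \<zeta>))"
    by (rule L_scale) (intro continuous_on_mult c continuous_poly_inverse)
  finally have main: "second_kind_star n z =
     z ^ n * L (\<lambda>\<zeta>. (\<zeta> + z) / (\<zeta> - z) * poly (\<phi>b n) (1 / \<zeta>)) - z ^ n * L (\<lambda>\<zeta>. poly (phis n) \<zeta> / \<zeta> ^ n)"
    by simp
  have last: "L (\<lambda>\<zeta>. poly (phis n) \<zeta> / \<zeta> ^ n) = (if n = 0 then 1 / \<kappa> n else 0)"
    by (rule pairing_phis_monom) simp
  show ?thesis
  proof (cases "n = 0")
    case True
    have "\<phi>b 0 = [:\<kappa> 0:]"
      using degree_phib[of 0] coeff_phib[of 0] by (metis degree_0_id)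
    then have "L (\<lambda>\<zeta>. (\<zeta> + z) / (\<zeta> - z) * poly (\<phi>b 0) (1 / \<zeta>)) = \<kappa> 0 * L (\<lambda>\<zeta>. (\<zeta> + z) / (\<zeta> - z))"
      by (simp add: L_scale[OF c, symmetric] mult.commute)
    with main last True show ?thesis by simp
  qed (use main last in simp)
qed

end

section \<open>Linear systems at a zero of the leading coefficient\<close>

text \<open>The Casoratian satisfies \<open>W (p f - q e)' = (a + d) (p f - q e)\<close>, since the contributions of
  \<open>\<plusminus>V\<close> cancel; as it is a multiple of \<open>z\<^sup>k\<close>, this says \<open>k W = z (a + d)\<close> on the punctured disc, hence
  everywhere. At \<open>x\<close> the system for \<open>(p, q)\<close> becomes a homogeneous linear one, whose determinant
  \<open>V\<^sup>2 - a\<^sup>2 - b c\<close> must vanish.\<close>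

lemma singular_point_identity:
  fixes p q a b c d W V :: "complex poly" and e f :: "complex \<Rightarrow> complex"
  assumes e: "e holomorphic_on ball 0 1" and f: "f holomorphic_on ball 0 1"
    and dp: "\<And>z. poly W z * poly (pderiv p) z = (poly a z - poly V z) * poly p z + poly b z * poly q z"
    and dq: "\<And>z. poly W z * poly (pderiv q) z = poly c z * poly p z + (poly d z - poly V z) * poly q z"
    and de: "\<And>z. norm z < 1 \<Longrightarrow> poly W z * deriv e z = (poly a z + poly V z) * e z + poly b z * f z"
    and df: "\<And>z. norm z < 1 \<Longrightarrow> poly W z * deriv f z = poly c z * e z + (poly d z + poly V z) * f z"
    and casoratian: "\<And>z. norm z < 1 \<Longrightarrow> poly p z * f z - poly q z * e z = C * z ^ k"
    and "C \<noteq> 0"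
    and x: "x \<noteq> 0" "poly W x = 0" and nz: "poly p x \<noteq> 0 \<or> poly q x \<noteq> 0"
  shows "poly a x + poly d x = 0"
    and "(poly a x)\<^sup>2 + poly b x * poly c x = (poly V x)\<^sup>2"
proof -
  have trace: "of_nat k * poly W z = z * (poly a z + poly d z)" if z: "norm z < 1" "z \<noteq> 0" for z
  proof -
    have "((\<lambda>z. poly p z * f z - poly q z * e z) has_field_derivative
        (poly p z * deriv f z + poly (pderiv p) z * f z) -
        (poly q z * deriv e z + poly (pderiv q) z * e z)) (at z)"
      using z by (intro DERIV_diff DERIV_mult' poly_DERIV holomorphic_derivI[OF e] holomorphic_derivI[OF f]) auto
    then have "((\<lambda>z. C * z ^ k) has_field_derivative
        (poly p z * deriv f z + poly (pderiv p) z * f z) -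
        (poly q z * deriv e z + poly (pderiv q) z * e z)) (at z)"
      by (rule has_field_derivative_transform_within_open[of _ _ _ "ball 0 1"])
        (use z casoratian in auto)
    moreover have "((\<lambda>z. C * z ^ k) has_field_derivative C * (of_nat k * z ^ (k - 1))) (at z)"
      by (auto intro!: derivative_eq_intros)
    ultimately have "C * (of_nat k * z ^ (k - 1)) =
        (poly p z * deriv f z + poly (pderiv p) z * f z) -
        (poly q z * deriv e z + poly (pderiv q) z * e z)"
      by (rule DERIV_unique[rotated])
    then have "poly W z * (C * (of_nat k * z ^ (k - 1))) = poly W z *
        ((poly p z * deriv f z + poly (pderiv p) z * f z) -
        (poly q z * deriv e z + poly (pderiv q) z * e z))"
      by (rule arg_cong)
    also have "\<dots> =
        poly p z * (poly W z * deriv f z) + (poly W z * poly (pderiv p) z) * f z -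
        (poly q z * (poly W z * deriv e z) + (poly W z * poly (pderiv q) z) * e z)"
      by (simp add: algebra_simps)
    also have "\<dots> = (poly a z + poly d z) * (poly p z * f z - poly q z * e z)"
      unfolding dp dq de[OF z(1)] df[OF z(1)] by (simp add: algebra_simps)
    also have "\<dots> = (poly a z + poly d z) * (C * z ^ k)"
      by (simp add: casoratian[OF z(1)])
    finally have "z * (poly W z * (C * (of_nat k * z ^ (k - 1)))) = z * ((poly a z + poly d z) * (C * z ^ k))"
      by simp
    \<comment> \<open>the extra factor \<open>z\<close> compensates the exponent \<open>k - 1\<close>, which is truncated at \<open>k = 0\<close>\<close>
    have "(C * z ^ k) * (of_nat k * poly W z) = z * (poly W z * (C * (of_nat k * z ^ (k - 1))))"
      by (cases k) simp_all
    also have "\<dots> = z * ((poly a z + poly d z) * (C * z ^ k))"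
      by fact
    also have "\<dots> = (C * z ^ k) * (z * (poly a z + poly d z))"
      by (simp only: mult_ac)
    finally have "(C * z ^ k) * (of_nat k * poly W z) = (C * z ^ k) * (z * (poly a z + poly d z))" .
    with z \<open>C \<noteq> 0\<close> show ?thesis by simp
  qed
  let ?T = "Polynomial.smult (of_nat k) W - pCons 0 (a + d)"
  have "ball 0 1 - {0} \<subseteq> {z. poly ?T z = 0}"
    using trace by auto
  moreover have "infinite (ball 0 1 - {0::complex})"
    using uncountable_ball[of 1 "0::complex"] uncountable_infinite by auto
  ultimately have "?T = 0" using poly_roots_finite[of ?T] finite_subset by blast
  then have "poly ?T x = 0" by simp
  then show tr: "poly a x + poly d x = 0" using x by simp
  have 1: "(poly a x - poly V x) * poly p x + poly b x * poly q x = 0"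
    using dp[of x] x by simp
  have d: "poly d x = - poly a x" using tr by (simp add: eq_neg_iff_add_eq_0 add.commute)
  have 2: "poly c x * poly p x + (- poly a x - poly V x) * poly q x = 0"
    using dq[of x] x unfolding d by simp
  \<comment> \<open>Cramer's rule: the determinant annihilates both components of the solution\<close>
  let ?\<Delta> = "(poly a x)\<^sup>2 + poly b x * poly c x - (poly V x)\<^sup>2"
  have "?\<Delta> * poly p x = (poly a x + poly V x) * ((poly a x - poly V x) * poly p x + poly b x * poly q x)
      + poly b x * (poly c x * poly p x + (- poly a x - poly V x) * poly q x)"
    by (simp add: algebra_simps power2_eq_square)
  moreover have "?\<Delta> * poly q x = poly c x * ((poly a x - poly V x) * poly p x + poly b x * poly q x)
      - (poly a x - poly V x) * (poly c x * poly p x + (- poly a x - poly V x) * poly q x)"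
    by (simp add: algebra_simps power2_eq_square)
  ultimately have "?\<Delta> = 0" using nz unfolding 1 2 by auto
  then show "(poly a x)\<^sup>2 + poly b x * poly c x = (poly V x)\<^sup>2" by simp
qed

section \<open>The bilinear identities\<close>

locale coefficient_system = biorthonormal_system L \<kappa> \<phi> \<phi>b for L \<kappa> \<phi> \<phi>b +
  fixes W V :: "complex poly" and \<Theta> \<Omega> \<Theta>s \<Omega>s :: "nat \<Rightarrow> complex poly"
  assumes r_nonzero: "\<And>n. r n \<noteq> 0" and rb_nonzero: "\<And>n. rb n \<noteq> 0"
    and deriv_phi: "\<And>n z. poly W z * poly (pderiv (\<phi> n)) z =
      poly (\<Theta> n) z * poly (\<phi> (Suc n)) z - (poly (\<Omega> n) z + poly V z) * poly (\<phi> n) z"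
    and deriv_phis: "\<And>n z. poly W z * poly (pderiv (phis n)) z =
      - poly (\<Theta>s n) z * poly (phis (Suc n)) z + (poly (\<Omega>s n) z - poly V z) * poly (phis n) z"
    and deriv_second_kind: "\<And>n z. norm z < 1 \<Longrightarrow> poly W z * deriv (second_kind n) z =
      poly (\<Theta> n) z * second_kind (Suc n) z - (poly (\<Omega> n) z - poly V z) * second_kind n z"
    and deriv_second_kind_star: "\<And>n z. norm z < 1 \<Longrightarrow> poly W z * deriv (second_kind_star n) z =
      - poly (\<Theta>s n) z * second_kind_star (Suc n) z + (poly (\<Omega>s n) z + poly V z) * second_kind_star n z"
begin

text \<open>The polynomials and the functions of the second kind form two such columns, so each consequence
  of the recurrences is derived once and used for both. The pairs for the bilinear identities
  require the successor of each member in terms of the pair itself; the formulas below supply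
  these changes of basis.\<close>

definition szego_column :: "complex \<Rightarrow> (nat \<Rightarrow> complex) \<Rightarrow> (nat \<Rightarrow> complex) \<Rightarrow> bool" where
  "szego_column z u s \<longleftrightarrow> (\<forall>n.
     \<kappa> n * u (Suc n) = \<kappa> (Suc n) * z * u n + r (Suc n) * s n \<and>
     \<kappa> n * s (Suc n) = \<kappa> (Suc n) * s n + rb (Suc n) * z * u n)"

lemma column_polys: "szego_column z (\<lambda>n. poly (\<phi> n) z) (\<lambda>n. poly (phis n) z)"
  by (simp add: szego_column_def szego_phi szego_phis)

lemma column_second_kind:
  "norm z < 1 \<Longrightarrow> szego_column z (\<lambda>n. second_kind n z) (\<lambda>n. second_kind_star n z)"
  by (simp add: szego_column_def szego_second_kind szego_second_kind_star)

context
  fixes z u s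
  assumes col: "szego_column z u s"
begin

lemma column_u: "u (Suc n) = \<kappa> (Suc n) / \<kappa> n * z * u n + r (Suc n) / \<kappa> n * s n"
  using col kappa_nonzero[of n] by (simp add: szego_column_def field_simps)

lemma column_s: "s (Suc n) = \<kappa> (Suc n) / \<kappa> n * s n + rb (Suc n) / \<kappa> n * z * u n"
  using col kappa_nonzero[of n] by (simp add: szego_column_def field_simps)

lemma column_s_mixed: "s (Suc n) = \<kappa> n / \<kappa> (Suc n) * s n + rb (Suc n) / \<kappa> (Suc n) * u (Suc n)"
proof -
  have "\<kappa> n * (\<kappa> (Suc n) * s (Suc n)) = \<kappa> (Suc n) * (\<kappa> n * s (Suc n))" by simp
  also have "\<dots> = (\<kappa> (Suc n))\<^sup>2 * s n + rb (Suc n) * (\<kappa> (Suc n) * z * u n)"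
    using col by (simp add: szego_column_def algebra_simps power2_eq_square)
  also have "\<kappa> (Suc n) * z * u n = \<kappa> n * u (Suc n) - r (Suc n) * s n"
    using col by (simp add: szego_column_def)
  also have "(\<kappa> (Suc n))\<^sup>2 * s n + rb (Suc n) * (\<kappa> n * u (Suc n) - r (Suc n) * s n) =
      \<kappa> n * (\<kappa> n * s n + rb (Suc n) * u (Suc n))"
    unfolding kappa_square by (simp add: algebra_simps power2_eq_square)
  finally have "\<kappa> (Suc n) * s (Suc n) = \<kappa> n * s n + rb (Suc n) * u (Suc n)"
    using kappa_nonzero[of n] by simp
  then show ?thesis using kappa_nonzero[of "Suc n"] by (simp add: field_simps)
qed

lemma column_u_mixed: "u (Suc n) = \<kappa> n / \<kappa> (Suc n) * z * u n + r (Suc n) / \<kappa> (Suc n) * s (Suc n)"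
proof -
  have "\<kappa> n * (\<kappa> (Suc n) * u (Suc n)) = \<kappa> (Suc n) * (\<kappa> n * u (Suc n))" by simp
  also have "\<dots> = (\<kappa> (Suc n))\<^sup>2 * z * u n + r (Suc n) * (\<kappa> (Suc n) * s n)"
    using col by (simp add: szego_column_def algebra_simps power2_eq_square)
  also have "\<kappa> (Suc n) * s n = \<kappa> n * s (Suc n) - rb (Suc n) * z * u n"
    using col by (simp add: szego_column_def)
  also have "(\<kappa> (Suc n))\<^sup>2 * z * u n + r (Suc n) * (\<kappa> n * s (Suc n) - rb (Suc n) * z * u n) =
      \<kappa> n * (\<kappa> n * z * u n + r (Suc n) * s (Suc n))"
    unfolding kappa_square by (simp add: algebra_simps power2_eq_square)
  finally have "\<kappa> (Suc n) * u (Suc n) = \<kappa> n * z * u n + r (Suc n) * s (Suc n)"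
    using kappa_nonzero[of n] by simp
  then show ?thesis using kappa_nonzero[of "Suc n"] by (simp add: field_simps)
qed

lemma column_u_mixed2: "u (Suc (Suc n)) =
    (\<kappa> (Suc (Suc n)) / \<kappa> (Suc n) * z + r (Suc (Suc n)) * rb (Suc n) / (\<kappa> (Suc n))\<^sup>2) * u (Suc n)
    + r (Suc (Suc n)) * \<kappa> n / (\<kappa> (Suc n))\<^sup>2 * s n"
  unfolding column_u[of "Suc n"] column_s_mixed[of n] by (simp add: algebra_simps power2_eq_square)

lemma column_s_mixed2: "s (Suc (Suc n)) =
    (\<kappa> (Suc (Suc n)) / \<kappa> (Suc n) + rb (Suc (Suc n)) * r (Suc n) * z / (\<kappa> (Suc n))\<^sup>2) * s (Suc n)
    + rb (Suc (Suc n)) * \<kappa> n / (\<kappa> (Suc n))\<^sup>2 * z\<^sup>2 * u n"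
  unfolding column_s[of "Suc n"] column_u_mixed[of n] by (simp add: algebra_simps power2_eq_square)

lemma three_term_u: "u (Suc (Suc n)) =
    (\<kappa> (Suc (Suc n)) / \<kappa> (Suc n) * z + r (Suc (Suc n)) / r (Suc n)) * u (Suc n)
    - \<kappa> n * r (Suc (Suc n)) / (\<kappa> (Suc n) * r (Suc n)) * z * u n"
proof -
  have s: "s (Suc n) = (\<kappa> (Suc n) * u (Suc n) - \<kappa> n * z * u n) / r (Suc n)"
    using column_u_mixed[of n] kappa_nonzero[of "Suc n"] r_nonzero[of "Suc n"] by (simp add: field_simps)
  then show ?thesis
    unfolding column_u[of "Suc n"] s using kappa_nonzero[of "Suc n"] r_nonzero[of "Suc n"]
    by (simp add: field_simps)
qed

lemma three_term_s: "s (Suc (Suc n)) =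
    (\<kappa> (Suc (Suc n)) / \<kappa> (Suc n) + rb (Suc (Suc n)) / rb (Suc n) * z) * s (Suc n)
    - \<kappa> n * rb (Suc (Suc n)) / (\<kappa> (Suc n) * rb (Suc n)) * z * s n"
proof -
  have u: "u (Suc n) = (\<kappa> (Suc n) * s (Suc n) - \<kappa> n * s n) / rb (Suc n)"
    using column_s_mixed[of n] kappa_nonzero[of "Suc n"] rb_nonzero[of "Suc n"] by (simp add: field_simps)
  then show ?thesis
    unfolding column_s[of "Suc n"] u using kappa_nonzero[of "Suc n"] rb_nonzero[of "Suc n"]
    by (simp add: field_simps)
qed

end

context
  fixes x
  assumes x: "x \<noteq> 0" "poly W x = 0"
begin

lemma identity_phi_phis:
  shows "poly (\<Omega> n) x - \<kappa> (Suc n) / \<kappa> n * x * poly (\<Theta> n) x =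
      poly (\<Omega>s n) x - \<kappa> (Suc n) / \<kappa> n * poly (\<Theta>s n) x" (is ?A)
    and "(poly (\<Omega> n) x - \<kappa> (Suc n) / \<kappa> n * x * poly (\<Theta> n) x)\<^sup>2 =
      r (Suc n) * rb (Suc n) / (\<kappa> n)\<^sup>2 * x * poly (\<Theta> n) x * poly (\<Theta>s n) x + (poly V x)\<^sup>2" (is ?B)
proof -
  define a where "a = Polynomial.smult (\<kappa> (Suc n) / \<kappa> n) (pCons 0 (\<Theta> n)) - \<Omega> n"
  define b where "b = Polynomial.smult (r (Suc n) / \<kappa> n) (\<Theta> n)"
  define c where "c = - Polynomial.smult (rb (Suc n) / \<kappa> n) (pCons 0 (\<Theta>s n))"
  define d where "d = \<Omega>s n - Polynomial.smult (\<kappa> (Suc n) / \<kappa> n) (\<Theta>s n)"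
  note defs = a_def b_def c_def d_def
  have dp: "poly W z * poly (pderiv (\<phi> n)) z =
      (poly a z - poly V z) * poly (\<phi> n) z + poly b z * poly (phis n) z" for z
    unfolding deriv_phi column_u[OF column_polys, of n z] by (simp add: defs algebra_simps)
  have dq: "poly W z * poly (pderiv (phis n)) z =
      poly c z * poly (\<phi> n) z + (poly d z - poly V z) * poly (phis n) z" for z
    unfolding deriv_phis column_s[OF column_polys, of n z] by (simp add: defs algebra_simps)
  have de: "poly W z * deriv (second_kind n) z =
      (poly a z + poly V z) * second_kind n z + poly b z * second_kind_star n z"
    if z: "norm z < 1" for z
    unfolding deriv_second_kind[OF z] column_u[OF column_second_kind[OF z], of n] by (simp add: defs algebra_simps)
  have df: "poly W z * deriv (second_kind_star n) z =
      poly c z * second_kind n z + (poly d z + poly V z) * second_kind_star n z"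
    if z: "norm z < 1" for z
    unfolding deriv_second_kind_star[OF z] column_s[OF column_second_kind[OF z], of n] by (simp add: defs algebra_simps)
  have C: "- 2 \<noteq> (0::complex)" by simp
  note id = singular_point_identity[OF second_kind_holomorphic second_kind_star_holomorphic
      dp dq de df casoratian C x phi_phis_no_common_zero[OF x(1)]]
  show ?A using id(1) by (simp add: defs algebra_simps)
  have "(- (poly a x))\<^sup>2 = (poly V x)\<^sup>2 - poly b x * poly c x" using id(2) by (simp add: algebra_simps)
  then show ?B by (simp add: defs algebra_simps power2_eq_square)
qed

lemma identity_phi_phi:
  shows "poly (\<Omega> (Suc n)) x + poly (\<Omega> n) x =
      (\<kappa> (Suc (Suc n)) / \<kappa> (Suc n) * x + r (Suc (Suc n)) / r (Suc n)) * poly (\<Theta> (Suc n)) x" (is ?A)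
    and "(poly (\<Omega> n) x)\<^sup>2 = \<kappa> n * r (Suc (Suc n)) / (\<kappa> (Suc n) * r (Suc n)) * x
      * poly (\<Theta> n) x * poly (\<Theta> (Suc n)) x + (poly V x)\<^sup>2" (is ?B)
proof -
  define \<beta> where "\<beta> = [:r (Suc (Suc n)) / r (Suc n), \<kappa> (Suc (Suc n)) / \<kappa> (Suc n):]"
  define \<gamma> where "\<gamma> = \<kappa> n * r (Suc (Suc n)) / (\<kappa> (Suc n) * r (Suc n))"
  define c where "c = - Polynomial.smult \<gamma> (pCons 0 (\<Theta> (Suc n)))"
  define d where "d = \<beta> * \<Theta> (Suc n) - \<Omega> (Suc n)"
  note defs = \<beta>_def \<gamma>_def c_def d_def
  have dp: "poly W z * poly (pderiv (\<phi> n)) z =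
      (poly (- \<Omega> n) z - poly V z) * poly (\<phi> n) z + poly (\<Theta> n) z * poly (\<phi> (Suc n)) z" for z
    unfolding deriv_phi by (simp add: algebra_simps)
  have dq: "poly W z * poly (pderiv (\<phi> (Suc n))) z =
      poly c z * poly (\<phi> n) z + (poly d z - poly V z) * poly (\<phi> (Suc n)) z" for z
    unfolding deriv_phi three_term_u[OF column_polys, of n z] by (simp add: defs algebra_simps)
  have de: "poly W z * deriv (second_kind n) z =
      (poly (- \<Omega> n) z + poly V z) * second_kind n z + poly (\<Theta> n) z * second_kind (Suc n) z"
    if z: "norm z < 1" for z
    unfolding deriv_second_kind[OF z] by (simp add: algebra_simps)
  have df: "poly W z * deriv (second_kind (Suc n)) z =
      poly c z * second_kind n z + (poly d z + poly V z) * second_kind (Suc n) z"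
    if z: "norm z < 1" for z
    unfolding deriv_second_kind[OF z] three_term_u[OF column_second_kind[OF z], of n]
    by (simp add: defs algebra_simps)
  have wr: "poly (\<phi> n) z * second_kind (Suc n) z - poly (\<phi> (Suc n)) z * second_kind n z
      = (- 2 * r (Suc n) / \<kappa> n) * z ^ n" if z: "norm z < 1" for z
  proof -
    have "poly (\<phi> n) z * second_kind (Suc n) z - poly (\<phi> (Suc n)) z * second_kind n z
      = r (Suc n) / \<kappa> n * (poly (\<phi> n) z * second_kind_star n z - poly (phis n) z * second_kind n z)"
      unfolding column_u[OF column_polys, of n z] column_u[OF column_second_kind[OF z], of n]
      by (simp add: algebra_simps)
    then show ?thesis unfolding casoratian[OF z] by simp
  qed
  have nz: "poly (\<phi> n) x \<noteq> 0 \<or> poly (\<phi> (Suc n)) x \<noteq> 0"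
    using phi_phis_no_common_zero[OF x(1), of n] column_u[OF column_polys, of n x]
      r_nonzero[of "Suc n"] kappa_nonzero[of n] by auto
  have C: "- 2 * r (Suc n) / \<kappa> n \<noteq> 0" using r_nonzero kappa_nonzero by simp
  note id = singular_point_identity[OF second_kind_holomorphic second_kind_holomorphic dp dq de df wr C x nz]
  show ?A using id(1) by (simp add: defs algebra_simps)
  show ?B using id(2) by (simp add: defs algebra_simps)
qed

lemma identity_phis_phis:
  shows "poly (\<Omega>s (Suc n)) x + poly (\<Omega>s n) x =
      (\<kappa> (Suc (Suc n)) / \<kappa> (Suc n) + rb (Suc (Suc n)) / rb (Suc n) * x) * poly (\<Theta>s (Suc n)) x" (is ?A)
    and "(poly (\<Omega>s n) x)\<^sup>2 = \<kappa> n * rb (Suc (Suc n)) / (\<kappa> (Suc n) * rb (Suc n)) * x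
      * poly (\<Theta>s n) x * poly (\<Theta>s (Suc n)) x + (poly V x)\<^sup>2" (is ?B)
proof -
  define \<beta> where "\<beta> = [:\<kappa> (Suc (Suc n)) / \<kappa> (Suc n), rb (Suc (Suc n)) / rb (Suc n):]"
  define \<gamma> where "\<gamma> = \<kappa> n * rb (Suc (Suc n)) / (\<kappa> (Suc n) * rb (Suc n))"
  define c where "c = Polynomial.smult \<gamma> (pCons 0 (\<Theta>s (Suc n)))"
  define d where "d = \<Omega>s (Suc n) - \<beta> * \<Theta>s (Suc n)"
  note defs = \<beta>_def \<gamma>_def c_def d_def
  have dp: "poly W z * poly (pderiv (phis n)) z =
      (poly (\<Omega>s n) z - poly V z) * poly (phis n) z + poly (- \<Theta>s n) z * poly (phis (Suc n)) z" for z
    unfolding deriv_phis by (simp add: algebra_simps)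
  have dq: "poly W z * poly (pderiv (phis (Suc n))) z =
      poly c z * poly (phis n) z + (poly d z - poly V z) * poly (phis (Suc n)) z" for z
    unfolding deriv_phis three_term_s[OF column_polys, of n z] by (simp add: defs algebra_simps)
  have de: "poly W z * deriv (second_kind_star n) z =
      (poly (\<Omega>s n) z + poly V z) * second_kind_star n z + poly (- \<Theta>s n) z * second_kind_star (Suc n) z"
    if z: "norm z < 1" for z
    unfolding deriv_second_kind_star[OF z] by (simp add: algebra_simps)
  have df: "poly W z * deriv (second_kind_star (Suc n)) z =
      poly c z * second_kind_star n z + (poly d z + poly V z) * second_kind_star (Suc n) z"
    if z: "norm z < 1" for z
    unfolding deriv_second_kind_star[OF z] three_term_s[OF column_second_kind[OF z], of n]
    by (simp add: defs algebra_simps)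
  have wr: "poly (phis n) z * second_kind_star (Suc n) z - poly (phis (Suc n)) z * second_kind_star n z
      = (2 * rb (Suc n) / \<kappa> n) * z ^ Suc n" if z: "norm z < 1" for z
  proof -
    have "poly (phis n) z * second_kind_star (Suc n) z - poly (phis (Suc n)) z * second_kind_star n z
      = - (rb (Suc n) / \<kappa> n * z * (poly (\<phi> n) z * second_kind_star n z - poly (phis n) z * second_kind n z))"
      unfolding column_s[OF column_polys, of n z] column_s[OF column_second_kind[OF z], of n]
      by (simp add: algebra_simps)
    then show ?thesis unfolding casoratian[OF z] by simp
  qed
  have nz: "poly (phis n) x \<noteq> 0 \<or> poly (phis (Suc n)) x \<noteq> 0"
    using phi_phis_no_common_zero[OF x(1), of n] column_s[OF column_polys, of n x]
      rb_nonzero[of "Suc n"] kappa_nonzero[of n] x(1) by auto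
  have C: "2 * rb (Suc n) / \<kappa> n \<noteq> 0" using rb_nonzero kappa_nonzero by simp
  note id = singular_point_identity[OF second_kind_star_holomorphic second_kind_star_holomorphic
      dp dq de df wr C x nz]
  show ?A using id(1) by (simp add: defs algebra_simps)
  show ?B using id(2) by (simp add: defs algebra_simps)
qed

text \<open>The upper left entry of the matrix for this pair contains \<open>\<Omega>\<^sub>n\<^sub>+\<^sub>1\<close>; the vanishing trace for the
  pair \<open>(\<phi>\<^sub>n, \<phi>\<^sub>n\<^sub>+\<^sub>1)\<close> replaces it by \<open>\<Omega>\<^sub>n\<close>, and \<open>kappa_square\<close> combines the two multiples of \<open>\<Theta>\<^sub>n\<^sub>+\<^sub>1\<close>.\<close>

lemma identity_phi_Suc_phis:
  "(poly (\<Omega> n) x - (\<kappa> n)\<^sup>2 / (\<kappa> (Suc n))\<^sup>2 * (r (Suc (Suc n)) / r (Suc n)) * poly (\<Theta> (Suc n)) x)\<^sup>2 =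
    \<kappa> n * r (Suc (Suc n)) * rb (Suc n) / (\<kappa> (Suc n))^3 * poly (\<Theta> (Suc n)) x * poly (\<Theta>s n) x + (poly V x)\<^sup>2"
proof -
  define \<beta> where "\<beta> = [:r (Suc (Suc n)) * rb (Suc n) / (\<kappa> (Suc n))\<^sup>2, \<kappa> (Suc (Suc n)) / \<kappa> (Suc n):]"
  define a where "a = \<beta> * \<Theta> (Suc n) - \<Omega> (Suc n)"
  define b where "b = Polynomial.smult (r (Suc (Suc n)) * \<kappa> n / (\<kappa> (Suc n))\<^sup>2) (\<Theta> (Suc n))"
  define c where "c = - Polynomial.smult (rb (Suc n) / \<kappa> (Suc n)) (\<Theta>s n)"
  define d where "d = \<Omega>s n - Polynomial.smult (\<kappa> n / \<kappa> (Suc n)) (\<Theta>s n)"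
  note defs = \<beta>_def a_def b_def c_def d_def
  have dp: "poly W z * poly (pderiv (\<phi> (Suc n))) z =
      (poly a z - poly V z) * poly (\<phi> (Suc n)) z + poly b z * poly (phis n) z" for z
    unfolding deriv_phi column_u_mixed2[OF column_polys, of n z] by (simp add: defs algebra_simps)
  have dq: "poly W z * poly (pderiv (phis n)) z =
      poly c z * poly (\<phi> (Suc n)) z + (poly d z - poly V z) * poly (phis n) z" for z
    unfolding deriv_phis column_s_mixed[OF column_polys, of n z] by (simp add: defs algebra_simps)
  have de: "poly W z * deriv (second_kind (Suc n)) z =
      (poly a z + poly V z) * second_kind (Suc n) z + poly b z * second_kind_star n z"
    if z: "norm z < 1" for z
    unfolding deriv_second_kind[OF z] column_u_mixed2[OF column_second_kind[OF z], of n]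
    by (simp add: defs algebra_simps)
  have df: "poly W z * deriv (second_kind_star n) z =
      poly c z * second_kind (Suc n) z + (poly d z + poly V z) * second_kind_star n z"
    if z: "norm z < 1" for z
    unfolding deriv_second_kind_star[OF z] column_s_mixed[OF column_second_kind[OF z], of n]
    by (simp add: defs algebra_simps)
  have wr: "poly (\<phi> (Suc n)) z * second_kind_star n z - poly (phis n) z * second_kind (Suc n) z
      = (- 2 * \<kappa> (Suc n) / \<kappa> n) * z ^ Suc n" if z: "norm z < 1" for z
  proof -
    have "poly (\<phi> (Suc n)) z * second_kind_star n z - poly (phis n) z * second_kind (Suc n) z
      = \<kappa> (Suc n) / \<kappa> n * z * (poly (\<phi> n) z * second_kind_star n z - poly (phis n) z * second_kind n z)"
      unfolding column_u[OF column_polys, of n z] column_u[OF column_second_kind[OF z], of n]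
      by (simp add: algebra_simps)
    then show ?thesis unfolding casoratian[OF z] by simp
  qed
  have nz: "poly (\<phi> (Suc n)) x \<noteq> 0 \<or> poly (phis n) x \<noteq> 0"
    using phi_phis_no_common_zero[OF x(1), of n] column_u[OF column_polys, of n x]
      kappa_nonzero x(1) by auto
  have C: "- 2 * \<kappa> (Suc n) / \<kappa> n \<noteq> 0" using kappa_nonzero by simp
  note id = singular_point_identity[OF second_kind_holomorphic second_kind_star_holomorphic
      dp dq de df wr C x nz]
  have R: "r (Suc (Suc n)) / r (Suc n) - r (Suc (Suc n)) * rb (Suc n) / (\<kappa> (Suc n))\<^sup>2 =
      (\<kappa> n)\<^sup>2 / (\<kappa> (Suc n))\<^sup>2 * (r (Suc (Suc n)) / r (Suc n))"
  proof -
    have K: "(\<kappa> n)\<^sup>2 = (\<kappa> (Suc n))\<^sup>2 - r (Suc n) * rb (Suc n)" by (simp add: kappa_square)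
    show ?thesis unfolding K using kappa_nonzero[of "Suc n"] r_nonzero[of "Suc n"] by (simp add: field_simps)
  qed
  have "poly a x = poly (\<Omega> n) x - (r (Suc (Suc n)) / r (Suc n)
      - r (Suc (Suc n)) * rb (Suc n) / (\<kappa> (Suc n))\<^sup>2) * poly (\<Theta> (Suc n)) x"
    using identity_phi_phi(1)[of n] by (simp add: defs algebra_simps)
  then have "(poly (\<Omega> n) x - (\<kappa> n)\<^sup>2 / (\<kappa> (Suc n))\<^sup>2 * (r (Suc (Suc n)) / r (Suc n)) * poly (\<Theta> (Suc n)) x)\<^sup>2
    = (poly a x)\<^sup>2" unfolding R by simp
  also have "\<dots> = - poly b x * poly c x + (poly V x)\<^sup>2" using id(2) by (simp add: algebra_simps)
  also have "- poly b x * poly c x =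
      \<kappa> n * r (Suc (Suc n)) * rb (Suc n) / (\<kappa> (Suc n))^3 * poly (\<Theta> (Suc n)) x * poly (\<Theta>s n) x"
    using kappa_nonzero[of "Suc n"] by (simp add: defs field_simps power2_eq_square power3_eq_cube)
  finally show ?thesis .
qed

text \<open>As before, now with the trace for the pair \<open>(\<phi>*\<^sub>n, \<phi>*\<^sub>n\<^sub>+\<^sub>1)\<close>.\<close>

lemma identity_phis_Suc_phi:
  "(poly (\<Omega>s n) x - (\<kappa> n)\<^sup>2 / (\<kappa> (Suc n))\<^sup>2 * (rb (Suc (Suc n)) / rb (Suc n)) * x * poly (\<Theta>s (Suc n)) x)\<^sup>2 =
    \<kappa> n * rb (Suc (Suc n)) * r (Suc n) / (\<kappa> (Suc n))^3 * x\<^sup>2 * poly (\<Theta>s (Suc n)) x * poly (\<Theta> n) x + (poly V x)\<^sup>2"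
proof -
  define \<beta> where "\<beta> = [:\<kappa> (Suc (Suc n)) / \<kappa> (Suc n), rb (Suc (Suc n)) * r (Suc n) / (\<kappa> (Suc n))\<^sup>2:]"
  define a where "a = \<Omega>s (Suc n) - \<beta> * \<Theta>s (Suc n)"
  define b where "b = - Polynomial.smult (rb (Suc (Suc n)) * \<kappa> n / (\<kappa> (Suc n))\<^sup>2) (pCons 0 (pCons 0 (\<Theta>s (Suc n))))"
  define c where "c = Polynomial.smult (r (Suc n) / \<kappa> (Suc n)) (\<Theta> n)"
  define d where "d = Polynomial.smult (\<kappa> n / \<kappa> (Suc n)) (pCons 0 (\<Theta> n)) - \<Omega> n"
  note defs = \<beta>_def a_def b_def c_def d_def
  have dp: "poly W z * poly (pderiv (phis (Suc n))) z =
      (poly a z - poly V z) * poly (phis (Suc n)) z + poly b z * poly (\<phi> n) z" for z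
    unfolding deriv_phis column_s_mixed2[OF column_polys, of n z] by (simp add: defs algebra_simps power2_eq_square)
  have dq: "poly W z * poly (pderiv (\<phi> n)) z =
      poly c z * poly (phis (Suc n)) z + (poly d z - poly V z) * poly (\<phi> n) z" for z
    unfolding deriv_phi column_u_mixed[OF column_polys, of n z] by (simp add: defs algebra_simps)
  have de: "poly W z * deriv (second_kind_star (Suc n)) z =
      (poly a z + poly V z) * second_kind_star (Suc n) z + poly b z * second_kind n z"
    if z: "norm z < 1" for z
    unfolding deriv_second_kind_star[OF z] column_s_mixed2[OF column_second_kind[OF z], of n]
    by (simp add: defs algebra_simps power2_eq_square)
  have df: "poly W z * deriv (second_kind n) z =
      poly c z * second_kind_star (Suc n) z + (poly d z + poly V z) * second_kind n z"
    if z: "norm z < 1" for z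
    unfolding deriv_second_kind[OF z] column_u_mixed[OF column_second_kind[OF z], of n]
    by (simp add: defs algebra_simps)
  have wr: "poly (phis (Suc n)) z * second_kind n z - poly (\<phi> n) z * second_kind_star (Suc n) z
      = (2 * \<kappa> (Suc n) / \<kappa> n) * z ^ n" if z: "norm z < 1" for z
  proof -
    have "poly (phis (Suc n)) z * second_kind n z - poly (\<phi> n) z * second_kind_star (Suc n) z
      = - (\<kappa> (Suc n) / \<kappa> n * (poly (\<phi> n) z * second_kind_star n z - poly (phis n) z * second_kind n z))"
      unfolding column_s[OF column_polys, of n z] column_s[OF column_second_kind[OF z], of n]
      by (simp add: algebra_simps)
    then show ?thesis unfolding casoratian[OF z] by simp
  qed
  have nz: "poly (phis (Suc n)) x \<noteq> 0 \<or> poly (\<phi> n) x \<noteq> 0"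
    using phi_phis_no_common_zero[OF x(1), of n] column_s[OF column_polys, of n x]
      kappa_nonzero by auto
  have C: "2 * \<kappa> (Suc n) / \<kappa> n \<noteq> 0" using kappa_nonzero by simp
  note id = singular_point_identity[OF second_kind_star_holomorphic second_kind_holomorphic
      dp dq de df wr C x nz]
  have R: "rb (Suc (Suc n)) / rb (Suc n) - rb (Suc (Suc n)) * r (Suc n) / (\<kappa> (Suc n))\<^sup>2 =
      (\<kappa> n)\<^sup>2 / (\<kappa> (Suc n))\<^sup>2 * (rb (Suc (Suc n)) / rb (Suc n))"
  proof -
    have K: "(\<kappa> n)\<^sup>2 = (\<kappa> (Suc n))\<^sup>2 - r (Suc n) * rb (Suc n)" by (simp add: kappa_square)
    show ?thesis unfolding K using kappa_nonzero[of "Suc n"] rb_nonzero[of "Suc n"] by (simp add: field_simps)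
  qed
  have "poly a x = - (poly (\<Omega>s n) x - (rb (Suc (Suc n)) / rb (Suc n)
      - rb (Suc (Suc n)) * r (Suc n) / (\<kappa> (Suc n))\<^sup>2) * x * poly (\<Theta>s (Suc n)) x)"
    using identity_phis_phis(1)[of n] by (simp add: defs algebra_simps)
  then have "(poly (\<Omega>s n) x - (\<kappa> n)\<^sup>2 / (\<kappa> (Suc n))\<^sup>2 * (rb (Suc (Suc n)) / rb (Suc n)) * x * poly (\<Theta>s (Suc n)) x)\<^sup>2
    = (poly a x)\<^sup>2" unfolding R by (simp only: power2_minus)
  also have "\<dots> = - poly b x * poly c x + (poly V x)\<^sup>2" using id(2) by (simp add: algebra_simps)
  also have "- poly b x * poly c x =
      \<kappa> n * rb (Suc (Suc n)) * r (Suc n) / (\<kappa> (Suc n))^3 * x\<^sup>2 * poly (\<Theta>s (Suc n)) x * poly (\<Theta> n) x"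
    using kappa_nonzero[of "Suc n"] by (simp add: defs field_simps power2_eq_square power3_eq_cube)
  finally show ?thesis .
qed

end

end

section \<open>Application to the weight\<close>

lemma circle_functional_weight:
  assumes w: "circle_integrable w"
  shows "circle_functional (\<lambda>f. circle_int (\<lambda>\<zeta>. w \<zeta> * f \<zeta>))"
proof -
  let ?I = "{-pi<..pi}"
  have w': "set_integrable lborel ?I (\<lambda>\<theta>. w (cis \<theta>))"
    using w by (simp add: circle_integrable_def)
  have integrable: "set_integrable lborel ?I (\<lambda>\<theta>. w (cis \<theta>) * f (cis \<theta>))"
    if f: "continuous_on (sphere 0 1) f" for f :: "complex \<Rightarrow> complex"
  proof -
    have "bounded (f ` sphere 0 1)"
      by (intro compact_imp_bounded compact_continuous_image f) simp
    then obtain M where M: "\<forall>x\<in>f ` sphere 0 1. norm x \<le> M"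
      unfolding bounded_iff by blast
    have "continuous_on UNIV (\<lambda>\<theta>. f (cis \<theta>))"
      by (rule continuous_on_compose2[OF f]) (auto intro!: continuous_intros)
    then have m: "(\<lambda>\<theta>. f (cis \<theta>)) \<in> borel_measurable lborel"
      by (simp add: borel_measurable_continuous_onI)
    have "(\<lambda>\<theta>. (indicator ?I \<theta> *\<^sub>R w (cis \<theta>)) * f (cis \<theta>)) \<in> borel_measurable lborel"
      by (intro borel_measurable_times m) (use w' in \<open>simp add: set_integrable_def borel_measurable_integrable\<close>)
    then have "set_borel_measurable lborel ?I (\<lambda>\<theta>. w (cis \<theta>) * f (cis \<theta>))"
      by (simp add: set_borel_measurable_def)
    moreover have "set_integrable lborel ?I (\<lambda>\<theta>. complex_of_real M * w (cis \<theta>))"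
      using w' by simp
    moreover have "norm (w (cis \<theta>) * f (cis \<theta>)) \<le> norm (complex_of_real M * w (cis \<theta>))" for \<theta>
    proof -
      have "norm (f (cis \<theta>)) \<le> M" using M by simp
      then show ?thesis by (simp add: norm_mult mult.commute mult_right_mono)
    qed
    ultimately show ?thesis by (intro set_integrable_bound[of _ _ _ "\<lambda>\<theta>. w (cis \<theta>) * f (cis \<theta>)"]) auto
  qed
  show ?thesis
  proof
    fix f g :: "complex \<Rightarrow> complex" and c :: complex
    show "circle_int (\<lambda>\<zeta>. w \<zeta> * f \<zeta>) = circle_int (\<lambda>\<zeta>. w \<zeta> * g \<zeta>)"
      if "\<And>\<zeta>. norm \<zeta> = 1 \<Longrightarrow> f \<zeta> = g \<zeta>"
      using that by (simp add: circle_int_def)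
    show "circle_int (\<lambda>\<zeta>. w \<zeta> * (f \<zeta> + g \<zeta>)) =
        circle_int (\<lambda>\<zeta>. w \<zeta> * f \<zeta>) + circle_int (\<lambda>\<zeta>. w \<zeta> * g \<zeta>)"
      if "continuous_on (sphere 0 1) f" "continuous_on (sphere 0 1) g"
      using integrable[OF that(1)] integrable[OF that(2)]
      by (simp add: circle_int_def distrib_left set_integral_add add_divide_distrib)
    show "circle_int (\<lambda>\<zeta>. w \<zeta> * (c * f \<zeta>)) = c * circle_int (\<lambda>\<zeta>. w \<zeta> * f \<zeta>)"
    proof -
      have "(\<lambda>\<theta>. w (cis \<theta>) * (c * f (cis \<theta>))) = (\<lambda>\<theta>. c * (w (cis \<theta>) * f (cis \<theta>)))"
        by (simp add: mult_ac)
      then show ?thesis by (simp add: circle_int_def)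
    qed
    let ?C = "(LINT \<theta>:?I|lborel. norm (w (cis \<theta>))) / (2 * pi)"
    show "\<exists>C. \<forall>f M. continuous_on (sphere 0 1) f \<longrightarrow> (\<forall>\<zeta>\<in>sphere 0 1. norm (f \<zeta>) \<le> M) \<longrightarrow>
        norm (circle_int (\<lambda>\<zeta>. w \<zeta> * f \<zeta>)) \<le> C * M"
    proof (intro exI[of _ ?C] allI impI)
      fix f :: "complex \<Rightarrow> complex" and M
      assume f: "continuous_on (sphere 0 1) f" and M: "\<forall>\<zeta>\<in>sphere 0 1. norm (f \<zeta>) \<le> M"
      have "norm (LINT \<theta>:?I|lborel. w (cis \<theta>) * f (cis \<theta>)) \<le>
          (LINT \<theta>:?I|lborel. norm (w (cis \<theta>) * f (cis \<theta>)))"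
        by (rule set_integral_norm_bound[OF integrable[OF f]])
      also have "\<dots> \<le> (LINT \<theta>:?I|lborel. M * norm (w (cis \<theta>)))"
      proof (rule set_integral_mono)
        show "set_integrable lborel ?I (\<lambda>\<theta>. norm (w (cis \<theta>) * f (cis \<theta>)))"
          by (rule set_integrable_norm[OF integrable[OF f]])
        show "set_integrable lborel ?I (\<lambda>\<theta>. M * norm (w (cis \<theta>)))"
          using set_integrable_norm[OF w'] by simp
        show "norm (w (cis \<theta>) * f (cis \<theta>)) \<le> M * norm (w (cis \<theta>))" for \<theta>
          using M by (simp add: norm_mult mult.commute mult_right_mono)
      qed
      also have "\<dots> = M * (LINT \<theta>:?I|lborel. norm (w (cis \<theta>)))" by simp
      finally show "norm (circle_int (\<lambda>\<zeta>. w \<zeta> * f \<zeta>)) \<le> ?C * M"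
        by (simp add: circle_int_def norm_divide norm_mult field_simps)
    qed
  qed
qed

theorem proposition3p2:
  fixes m :: nat and zs \<rho> :: "nat \<Rightarrow> complex"
    and D :: "complex set" and w :: "complex \<Rightarrow> complex"
    and \<kappa> :: "nat \<Rightarrow> complex" and \<phi> \<phi>b :: "nat \<Rightarrow> complex poly"
    and \<Theta> \<Omega> \<Theta>s \<Omega>s :: "nat \<Rightarrow> complex poly"
  assumes "m \<ge> 2" and "inj_on zs {1..m}"
    and "\<And>j. j \<in> {1..m} \<Longrightarrow> \<rho> j \<notin> \<nat>"
    and "poly (W_poly m zs) 0 = 0"
    and "cut_plane D" and "weight_branch m zs \<rho> D w"
    and "sphere 0 1 - insert (-1) (zs ` {1..m}) \<subseteq> D"
    and "\<exists>c. ((\<lambda>\<theta>. w (cis \<theta>)) \<longlongrightarrow> c) (at_left pi) \<and> ((\<lambda>\<theta>. w (cis \<theta>)) \<longlongrightarrow> c) (at_right (- pi))"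
    and "\<And>k::int. circle_integrable (\<lambda>\<zeta>. \<zeta> powi k * w \<zeta>)"
    and "\<And>k::int. circle_integrable (\<lambda>\<zeta>. \<zeta> powi k * deriv w \<zeta>)"
    and "\<And>n. n \<ge> 1 \<Longrightarrow> toeplitz_det w n \<noteq> 0"
    and "biorthonormal w \<kappa> \<phi> \<phi>b"
    and "\<And>n. poly (\<phi> n) 0 \<noteq> 0" and "\<And>n. poly (\<phi>b n) 0 \<noteq> 0"
    and "coefficient_functions (W_poly m zs) (V_poly m zs \<rho>) w \<kappa> \<phi> \<phi>b \<Theta> \<Omega> \<Theta>s \<Omega>s"
  shows "\<forall>j\<in>{1..m}. zs j \<noteq> 0 \<longrightarrow>
    (let x = zs j; v = poly (V_poly m zs \<rho>) x;
         r = (\<lambda>n. poly (\<phi> n) 0); rb = (\<lambda>n. poly (\<phi>b n) 0);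
         \<theta> = (\<lambda>n. poly (\<Theta> n) x); \<omega> = (\<lambda>n. poly (\<Omega> n) x);
         \<theta>s = (\<lambda>n. poly (\<Theta>s n) x); \<omega>s = (\<lambda>n. poly (\<Omega>s n) x)
     in
      (\<forall>n. (\<omega> n)^2 = \<kappa> n * r (n+2) / (\<kappa> (n+1) * r (n+1)) * x * \<theta> n * \<theta> (n+1) + v^2) \<and>
      (\<forall>n. (\<omega>s n)^2 = \<kappa> n * rb (n+2) / (\<kappa> (n+1) * rb (n+1)) * x * \<theta>s n * \<theta>s (n+1) + v^2) \<and>
      (\<forall>n\<ge>1. (\<omega> (n-1) - (\<kappa> (n-1))^2 / (\<kappa> n)^2 * (r (n+1) / r n) * \<theta> n)^2
         = \<kappa> (n-1) * r (n+1) * rb n / (\<kappa> n)^3 * \<theta> n * \<theta>s (n-1) + v^2) \<and>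
      (\<forall>n\<ge>1. (\<omega>s (n-1) - (\<kappa> (n-1))^2 / (\<kappa> n)^2 * (rb (n+1) / rb n) * x * \<theta>s n)^2
         = \<kappa> (n-1) * rb (n+1) * r n / (\<kappa> n)^3 * x^2 * \<theta>s n * \<theta> (n-1) + v^2) \<and>
      (\<forall>n. r (n+1) * rb (n+1) / (\<kappa> n)^2 * x * \<theta> n * \<theta>s n + v^2
             = (\<omega> n - \<kappa> (n+1) / \<kappa> n * x * \<theta> n)^2 \<and>
           (\<omega> n - \<kappa> (n+1) / \<kappa> n * x * \<theta> n)^2
             = (\<omega>s n - \<kappa> (n+1) / \<kappa> n * \<theta>s n)^2))"
proof -
  let ?W = "W_poly m zs" and ?V = "V_poly m zs \<rho>"
  define L where "L = (\<lambda>f. circle_int (\<lambda>\<zeta>. w \<zeta> * f \<zeta>))"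
  have "circle_integrable w"
    using assms(9)[of 0] by simp
  then interpret circle_functional L
    unfolding L_def by (rule circle_functional_weight)
  interpret biorthonormal_system L \<kappa> \<phi> \<phi>b
  proof
    show "L (\<lambda>\<zeta>. poly (\<phi> k) \<zeta> * poly (\<phi>b n) (1 / \<zeta>)) = (if k = n then 1 else 0)" for k n
      using assms(12) by (simp add: biorthonormal_def L_def mult.assoc)
    show "\<kappa> n \<noteq> 0" "degree (\<phi> n) = n" "degree (\<phi>b n) = n" for n
      using assms(12) by (simp_all add: biorthonormal_def)
    show "coeff (\<phi> n) n = \<kappa> n" "coeff (\<phi>b n) n = \<kappa> n" for n
      using assms(12) unfolding biorthonormal_def by metis+
  qed
  have eps: "eps w \<kappa> \<phi> n z = second_kind n z" if "norm z < 1" for n z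
    unfolding second_kind_eq_herglotz[OF that]
    by (simp add: eps_def F_fun_def L_def mult_ac)
  have eps_star: "eps_star w \<kappa> \<phi>b n z = - second_kind_star n z" if "norm z < 1" for n z
    unfolding second_kind_star_eq_herglotz[OF that]
    by (simp add: eps_star_def F_fun_def L_def mult_ac)
  have deriv_eps: "deriv (eps w \<kappa> \<phi> n) z = deriv (second_kind n) z" if "norm z < 1" for n z
    by (intro deriv_cong_ev eventually_nhds_in_open[of "ball 0 1", THEN eventually_mono] eps refl)
      (use that in auto)
  have deriv_eps_star: "deriv (eps_star w \<kappa> \<phi>b n) z = - deriv (second_kind_star n) z"
    if z: "norm z < 1" for n z
  proof -
    have "deriv (eps_star w \<kappa> \<phi>b n) z = deriv (\<lambda>z. - second_kind_star n z) z"
      by (intro deriv_cong_ev eventually_nhds_in_open[of "ball 0 1", THEN eventually_mono] eps_star refl)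
        (use z in auto)
    also have "\<dots> = - deriv (second_kind_star n) z"
      using z second_kind_star_holomorphic[of n]
      by (intro deriv_minus) (auto intro: holomorphic_on_imp_differentiable_at)
    finally show ?thesis .
  qed
  have cf: "?W * pderiv (\<phi> n) = \<Theta> n * \<phi> (n+1) - (\<Omega> n + ?V) * \<phi> n"
      "?W * pderiv (phis n) = - \<Theta>s n * phis (n+1) + (\<Omega>s n - ?V) * phis n"
      "norm z \<noteq> 1 \<Longrightarrow> poly ?W z * deriv (eps w \<kappa> \<phi> n) z =
         poly (\<Theta> n) z * eps w \<kappa> \<phi> (n+1) z - poly (\<Omega> n - ?V) z * eps w \<kappa> \<phi> n z"
      "norm z \<noteq> 1 \<Longrightarrow> poly ?W z * deriv (eps_star w \<kappa> \<phi>b n) z =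
         - poly (\<Theta>s n) z * eps_star w \<kappa> \<phi>b (n+1) z + poly (\<Omega>s n + ?V) z * eps_star w \<kappa> \<phi>b n z" for n z
    using assms(15) unfolding coefficient_functions_def by blast+
  interpret coefficient_system L \<kappa> \<phi> \<phi>b ?W ?V \<Theta> \<Omega> \<Theta>s \<Omega>s
  proof
    fix n z
    show "poly (\<phi> n) 0 \<noteq> 0" "poly (\<phi>b n) 0 \<noteq> 0" by (fact assms)+
    show "poly ?W z * poly (pderiv (\<phi> n)) z =
        poly (\<Theta> n) z * poly (\<phi> (Suc n)) z - (poly (\<Omega> n) z + poly ?V z) * poly (\<phi> n) z"
      using arg_cong[OF cf(1), of "\<lambda>p. poly p z"] by simp
    show "poly ?W z * poly (pderiv (phis n)) z =
        - poly (\<Theta>s n) z * poly (phis (Suc n)) z + (poly (\<Omega>s n) z - poly ?V z) * poly (phis n) z"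
      using arg_cong[OF cf(2), of "\<lambda>p. poly p z"] by simp
    assume z: "norm z < 1"
    show "poly ?W z * deriv (second_kind n) z =
        poly (\<Theta> n) z * second_kind (Suc n) z - (poly (\<Omega> n) z - poly ?V z) * second_kind n z"
      using cf(3)[of z n] z by (simp add: eps deriv_eps)
    show "poly ?W z * deriv (second_kind_star n) z =
        - poly (\<Theta>s n) z * second_kind_star (Suc n) z
        + (poly (\<Omega>s n) z + poly ?V z) * second_kind_star n z"
      using cf(4)[of z n] z by (simp add: eps_star deriv_eps_star algebra_simps)
  qed
  have W0: "poly ?W (zs j) = 0" if "j \<in> {1..m}" for j
    using that by (auto simp: W_poly_def poly_prod)
  show ?thesis
  proof (intro ballI impI, unfold Let_def, intro conjI allI impI)
    fix j assume j: "j \<in> {1..m}" "zs j \<noteq> 0"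
    note x = j(2) W0[OF j(1)]
    fix n
    show "(poly (\<Omega> n) (zs j))\<^sup>2 = \<kappa> n * r (n+2) / (\<kappa> (n+1) * r (n+1)) * zs j
        * poly (\<Theta> n) (zs j) * poly (\<Theta> (n+1)) (zs j) + (poly ?V (zs j))\<^sup>2"
      using identity_phi_phi(2)[OF x, of n] by simp
    show "(poly (\<Omega>s n) (zs j))\<^sup>2 = \<kappa> n * rb (n+2) / (\<kappa> (n+1) * rb (n+1)) * zs j
        * poly (\<Theta>s n) (zs j) * poly (\<Theta>s (n+1)) (zs j) + (poly ?V (zs j))\<^sup>2"
      using identity_phis_phis(2)[OF x, of n] by simp
    show "r (n+1) * rb (n+1) / (\<kappa> n)\<^sup>2 * zs j * poly (\<Theta> n) (zs j) * poly (\<Theta>s n) (zs j) + (poly ?V (zs j))\<^sup>2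
        = (poly (\<Omega> n) (zs j) - \<kappa> (n+1) / \<kappa> n * zs j * poly (\<Theta> n) (zs j))\<^sup>2"
      using identity_phi_phis(2)[OF x, of n] by simp
    show "(poly (\<Omega> n) (zs j) - \<kappa> (n+1) / \<kappa> n * zs j * poly (\<Theta> n) (zs j))\<^sup>2
        = (poly (\<Omega>s n) (zs j) - \<kappa> (n+1) / \<kappa> n * poly (\<Theta>s n) (zs j))\<^sup>2"
      using identity_phi_phis(1)[OF x, of n] by simp
    assume "n \<ge> 1"
    then obtain k where n: "n = Suc k" by (cases n) auto
    show "(poly (\<Omega> (n-1)) (zs j) - (\<kappa> (n-1))\<^sup>2 / (\<kappa> n)\<^sup>2 * (r (n+1) / r n) * poly (\<Theta> n) (zs j))\<^sup>2
        = \<kappa> (n-1) * r (n+1) * rb n / (\<kappa> n)^3 * poly (\<Theta> n) (zs j) * poly (\<Theta>s (n-1)) (zs j)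
          + (poly ?V (zs j))\<^sup>2"
      using identity_phi_Suc_phis[OF x, of k] by (simp add: n)
    show "(poly (\<Omega>s (n-1)) (zs j) - (\<kappa> (n-1))\<^sup>2 / (\<kappa> n)\<^sup>2 * (rb (n+1) / rb n) * zs j * poly (\<Theta>s n) (zs j))\<^sup>2
        = \<kappa> (n-1) * rb (n+1) * r n / (\<kappa> n)^3 * (zs j)\<^sup>2 * poly (\<Theta>s n) (zs j) * poly (\<Theta> (n-1)) (zs j)
          + (poly ?V (zs j))\<^sup>2"
      using identity_phis_Suc_phi[OF x, of k] by (simp add: n)
  qed
qed

end
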